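(* Let $\mathsf{M}$ be a matroid of corank $2$ (i.e. $\operatorname{rk}\mathsf{M}=n-2$) on a ground set $E$ of size $n$, without coloops. For each integer $r$, let $\lambda_r$ be the number of stressed subsets of $\mathsf{M}$ of rank $r$ and size $r+1$. Then \begin{align*} Q_{\mathsf{M}}(x)&=Q_{\mathsf{U}_{n-2,n}}(x)-\sum_r\lambda_r\sum_{a=2}^{n-r-1}\Big(Q_{\mathsf{C}_{a,n+1-a}}(x)-Q_{\mathsf{U}_{a-1,a}}(x)\,Q_{\mathsf{U}_{n-a-1,n-a}}(x)\Big),\\ Y_{\mathsf{M}}(x)&=Y_{\mathsf{U}_{n-2,n}}(x)-\sum_r\lambda_r\sum_{a=2}^{n-r-1}\Big(Y_{\mathsf{C}_{a,n+1-a}}(x)-Y_{\mathsf{U}_{a-1,a}}(x)\,Y_{\mathsf{U}_{n-a-1,n-a}}(x)\Big). \end{align*} In particular, if $E=[n]$ and $\mathsf{M}$ is the matroid arising from a set partition $\lambda$ of $[n]$, then \begin{align*} Q_{\mathsf{M}}(x)&=Q_{\mathsf{U}_{n-2,n}}(x)-\sum_{S\in\lambda,\,|S|\ge2}\ \sum_{a=2}^{|S|}\Big(Q_{\mathsf{C}_{a,n+1-a}}(x)-Q_{\mathsf{U}_{a-1,a}}(x)\,Q_{\mathsf{U}_{n-a-1,n-a}}(x)\Big),\\ Y_{\mathsf{M}}(x)&=Y_{\mathsf{U}_{n-2,n}}(x)-\sum_{S\in\lambda,\,|S|\ge2}\ \sum_{a=2}^{|S|}\Big(Y_{\mathsf{C}_{a,n+1-a}}(x)-Y_{\mathsf{U}_{a-1,a}}(x)\,Y_{\mathsf{U}_{n-a-1,n-a}}(x)\Big).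 \end{align*}
   Context: A subset $A\subseteq E$ is stressed if both $\mathsf{M}/A$ and $\mathsf{M}|_A$ are uniform matroids. $\mathsf{U}_{k,m}$ is the uniform matroid of rank $k$ on $m$ elements. For $a,b\ge2$, $\mathsf{C}_{a,b}$ is the graphic matroid of the graph obtained by gluing a cycle of length $a$ and a cycle of length $b$ along a common edge. The matroid arising from a set partition $\lambda$ of $[n]$ is the dual of the loopless rank-$2$ matroid on $[n]$ whose rank-$1$ flats are exactly the blocks of $\lambda$. $\mu(\mathsf{N})$ is the Möbius value $\mu(\varnothing,E)$ of the lattice of flats $\mathcal{L}(\mathsf{N})$. The inverse Kazhdan–Lusztig polynomial $Q_{\mathsf{N}}$ is the unique assignment to loopless matroids with $Q_{\mathsf{N}}=1$ in rank $0$, $\deg Q_{\mathsf{N}}<\operatorname{rk}(\mathsf{N})/2$ in positive rank, and $Y_{\mathsf{N}}(x):=\sum_{F}(-1)^{\operatorname{rk}\mathsf{N}-\operatorname{rk}F}\mu(\mathsf{N}/F)x^{\operatorname{rk}\mathsf{N}-\operatorname{rk}F}Q_{\mathsf{N}|_F}(x)$ palindromic of degree $\operatorname{rk}\mathsf{N}$; $Y_{\mathsf{N}}$ is the inverse $Z$-polynomial. *)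

theory Defs
  imports "HOL-Computational_Algebra.Polynomial" "HOL-Library.Disjoint_Sets"
begin

section \<open>Matroids\<close>

record 'a indep_system =
  ground :: "'a set"
  indep :: "'a set set"

definition matroid :: "'a indep_system \<Rightarrow> bool" where
  "matroid M \<longleftrightarrow> finite (ground M) \<and> indep M \<subseteq> Pow (ground M) \<and> {} \<in> indep M
    \<and> (\<forall>X\<in>indep M. \<forall>Y. Y \<subseteq> X \<longrightarrow> Y \<in> indep M)
    \<and> (\<forall>X\<in>indep M. \<forall>Y\<in>indep M. card X < card Y \<longrightarrow> (\<exists>y\<in>Y - X. insert y X \<in> indep M))"

definition rk :: "'a indep_system \<Rightarrow> 'a set \<Rightarrow> nat" where
  "rk M A = Max (card ` {X \<in> indep M. X \<subseteq> A})"

abbreviation rank :: "'a indep_system \<Rightarrow> nat" where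
  "rank M \<equiv> rk M (ground M)"

definition basis :: "'a indep_system \<Rightarrow> 'a set \<Rightarrow> bool" where
  "basis M B \<longleftrightarrow> B \<in> indep M \<and> (\<forall>X\<in>indep M. B \<subseteq> X \<longrightarrow> X = B)"

definition loopless :: "'a indep_system \<Rightarrow> bool" where
  "loopless M \<longleftrightarrow> (\<forall>e\<in>ground M. {e} \<in> indep M)"

definition coloop :: "'a indep_system \<Rightarrow> 'a \<Rightarrow> bool" where
  "coloop M e \<longleftrightarrow> e \<in> ground M \<and> (\<forall>B. basis M B \<longrightarrow> e \<in> B)"

definition flat :: "'a indep_system \<Rightarrow> 'a set \<Rightarrow> bool" where
  "flat M F \<longleftrightarrow> F \<subseteq> ground M \<and> (\<forall>e\<in>ground M - F. rk M F < rk M (insert e F))"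

definition dual :: "'a indep_system \<Rightarrow> 'a indep_system" where
  "dual M = \<lparr>ground = ground M,
    indep = {X. X \<subseteq> ground M \<and> (\<exists>B. basis M B \<and> X \<inter> B = {})}\<rparr>"

definition restrict :: "'a indep_system \<Rightarrow> 'a set \<Rightarrow> 'a indep_system" where
  "restrict M A = \<lparr>ground = A, indep = {X \<in> indep M. X \<subseteq> A}\<rparr>"

text \<open>The rank function of the contraction is \<open>X \<mapsto> rk M (X \<union> A) - rk M A\<close>.\<close>

definition contract :: "'a indep_system \<Rightarrow> 'a set \<Rightarrow> 'a indep_system" where
  "contract M A = \<lparr>ground = ground M - A,
    indep = {X. X \<subseteq> ground M - A \<and> rk M (X \<union> A) = card X + rk M A}\<rparr>"

definition uniform_on :: "'a set \<Rightarrow> nat \<Rightarrow> 'a indep_system" where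
  "uniform_on E k = \<lparr>ground = E, indep = {X. X \<subseteq> E \<and> card X \<le> k}\<rparr>"

definition uniform :: "'a indep_system \<Rightarrow> bool" where
  "uniform M \<longleftrightarrow> (\<exists>k \<le> card (ground M). M = uniform_on (ground M) k)"

definition U :: "nat \<Rightarrow> nat \<Rightarrow> nat indep_system" where
  "U k m = uniform_on {..<m} k"

definition stressed :: "'a indep_system \<Rightarrow> 'a set \<Rightarrow> bool" where
  "stressed M A \<longleftrightarrow> A \<subseteq> ground M \<and> uniform (contract M A) \<and> uniform (restrict M A)"

definition num_stressed :: "'a indep_system \<Rightarrow> nat \<Rightarrow> nat" where
  "num_stressed M r = card {A. stressed M A \<and> rk M A = r \<and> card A = r + 1}"

section \<open>The graphic matroids of two glued cycles\<close>

text \<open>A multigraph is given by the map sending an edge to its set of endpoints (a singleton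
  for a loop). A cycle of length 1 is a loop, one of length 2 a pair of parallel edges.\<close>

definition graph_cycle :: "('e \<Rightarrow> 'v set) \<Rightarrow> 'e list \<Rightarrow> bool" where
  "graph_cycle ends es \<longleftrightarrow> es \<noteq> [] \<and> distinct es
    \<and> (\<exists>vs. length vs = length es \<and> distinct vs
        \<and> (\<forall>i<length es. ends (es ! i) = {vs ! i, vs ! (Suc i mod length es)}))"

definition graphic_matroid :: "'e set \<Rightarrow> ('e \<Rightarrow> 'v set) \<Rightarrow> 'e indep_system" where
  "graphic_matroid E ends = \<lparr>ground = E,
    indep = {X. X \<subseteq> E \<and> \<not> (\<exists>es. set es \<subseteq> X \<and> graph_cycle ends es)}\<rparr>"

text \<open>The edges \<open>0, \<dots>, a - 1\<close> form a cycle of length \<open>a\<close> on the vertices \<open>0, \<dots>, a - 1\<close>.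
  The edges \<open>a, \<dots>, a + b - 2\<close> form a path of length \<open>b - 1\<close> through the vertices
  \<open>a - 1, a, \<dots>, a + b - 3, 0\<close>, which the common edge \<open>a - 1\<close> (with endpoints \<open>a - 1\<close> and \<open>0\<close>)
  closes to a cycle of length \<open>b\<close>. Intended for \<open>a, b \<ge> 2\<close>.\<close>

definition glued_cycles_ends :: "nat \<Rightarrow> nat \<Rightarrow> nat \<Rightarrow> nat set" where
  "glued_cycles_ends a b i =
    (if i < a then {i, Suc i mod a} else {i - 1, i mod (a + b - 2)})"

definition C :: "nat \<Rightarrow> nat \<Rightarrow> nat indep_system" where
  "C a b = graphic_matroid {..<a + b - 1} (glued_cycles_ends a b)"

section \<open>The matroid of a set partition\<close>

text \<open>Such an \<open>N\<close> exists precisely for the partitions with at least two blocks.\<close>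

definition arises_from_partition :: "'a indep_system \<Rightarrow> 'a set \<Rightarrow> 'a set set \<Rightarrow> bool" where
  "arises_from_partition M E P \<longleftrightarrow> partition_on E P
    \<and> (\<exists>N. matroid N \<and> ground N = E \<and> loopless N \<and> rank N = 2
        \<and> {F. flat N F \<and> rk N F = 1} = P \<and> M = dual N)"

section \<open>Moebius values and inverse Kazhdan--Lusztig polynomials\<close>

text \<open>The Moebius function of a family \<open>L\<close> of finite sets ordered by inclusion.\<close>

function moebius :: "'a set set \<Rightarrow> 'a set \<Rightarrow> 'a set \<Rightarrow> int" where
  "moebius L A B =
    (if A = B then 1
     else if A \<subset> B \<and> finite B then - (\<Sum>D\<in>{D \<in> L. A \<subseteq> D \<and> D \<subset> B}. moebius L A D)
     else 0)"
  by auto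
termination
  by (relation "measure (\<lambda>(L, A, B). card B)") (auto intro: psubset_card_mono)

declare moebius.simps [simp del]

text \<open>Only used for loopless \<open>M\<close>, so that the empty set is the least flat.\<close>

definition mu :: "'a indep_system \<Rightarrow> int" where
  "mu M = moebius {F. flat M F} {} (ground M)"

definition palindromic :: "nat \<Rightarrow> int poly \<Rightarrow> bool" where
  "palindromic d p \<longleftrightarrow> degree p \<le> d \<and> (\<forall>i\<le>d. coeff p i = coeff p (d - i))"

definition inv_Z_sum :: "('a indep_system \<Rightarrow> int poly) \<Rightarrow> 'a indep_system \<Rightarrow> int poly" where
  "inv_Z_sum Q N = (\<Sum>F\<in>{F. flat N F}.
    monom ((-1) ^ (rank N - rk N F) * mu (contract N F)) (rank N - rk N F) * Q (restrict N F))"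

text \<open>The inverse Kazhdan--Lusztig polynomial is characterized on loopless matroids; as usual it
  is extended by \<open>0\<close> to matroids with loops. (Then the inverse Z-polynomial, given by the same sum
  over flats, also vanishes there, because every flat contains all loops.)
  The junk value on non-matroids is also \<open>0\<close>, so that the assignment is unique.\<close>

definition is_inv_KL :: "('a indep_system \<Rightarrow> int poly) \<Rightarrow> bool" where
  "is_inv_KL Q \<longleftrightarrow>
    (\<forall>N. matroid N \<and> loopless N \<longrightarrow>
      (rank N = 0 \<longrightarrow> Q N = 1) \<and>
      (rank N > 0 \<longrightarrow> 2 * degree (Q N) < rank N) \<and>
      palindromic (rank N) (inv_Z_sum Q N)) \<and>
    (\<forall>N. \<not> (matroid N \<and> loopless N) \<longrightarrow> Q N = 0)"

definition inv_KL :: "'a indep_system \<Rightarrow> int poly" where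
  "inv_KL = (THE Q. is_inv_KL Q)"

definition inv_Z :: "'a indep_system \<Rightarrow> int poly" where
  "inv_Z = inv_Z_sum inv_KL"

end

(*
  A matroid of corank 2 without coloops on n elements is the dual of a loopless rank-2 matroid,
  hence determined by the partition P of its ground set into parallel classes of the dual; its
  circuits are the complements of the blocks, and they are exactly the stressed subsets counted by
  the theorem.  Whitney's formula turns the sum over flats defining the inverse Z-polynomial Y into
  a sum over all subsets T of the ground set (T being the complement of a flat), in which the
  proper restrictions of M are circuits plus coloops or free matroids.  Counting by blocks gives
    Y - Q = kappa n + (sum over blocks S of rho n |S|),  where rho n 1 = 0.
  Palindromicity determines Q from Y - Q by a linear truncation, so Q and Y are, up to a constant
  depending on n, sums over the blocks of a function of the block size.  The glued cycles C_{a,n+1-a}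
  have blocks of sizes a - 1, n - a, 1, and the product of two circuits has the values of the
  partition with blocks of sizes a, n - a; hence the sum over a telescopes to -rho n |S|.
*)

theory Submission
  imports Defs
begin

section \<open>Rank, closure and contraction\<close>

text \<open>Flats never have to be determined: the Moebius value of a contraction is a signed count
  of spanning sets, which makes sense for every T and is 0 when the complement of T is not a flat,
  so all subsets may enter the sum.

  The obstacle is the product of the two uniform matroids, the one quadratic ingredient among
  quantities that are additive over blocks. No direct sum of matroids is formed. For blocks of sizes
  a and b = n - a, the polynomial identity \<open>H_product\<close> shows that \<open>kappa\<close>
  and the two values of \<open>rho\<close> complete \<open>qcirc a * qcirc b\<close> to a product of
  two palindromic polynomials; since low degree and palindromicity are both multiplicative,
  uniqueness of truncation identifies \<open>qcirc a * qcirc b\<close>.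

  Loops need care: a block of size n - 1 produces one, and the range of a then ends with the factor
  \<open>U 0 1\<close>. The convention that Q and Y are 0 there agrees with the general formulas
  because \<open>qcirc 1\<close> and \<open>H 1\<close> vanish.\<close>

definition closure :: "'a indep_system \<Rightarrow> 'a set \<Rightarrow> 'a set" where
  "closure M A = {e \<in> ground M. rk M (insert e A) = rk M A}"

context
  fixes M :: "'a indep_system"
  assumes M: "matroid M"
begin

section \<open>Independence and rank\<close>

lemma finite_ground: "finite (ground M)"
  and indep_subset_ground: "X \<in> indep M \<Longrightarrow> X \<subseteq> ground M"
  and empty_indep: "{} \<in> indep M"
  and indep_subset: "X \<in> indep M \<Longrightarrow> Y \<subseteq> X \<Longrightarrow> Y \<in> indep M"
  and indep_augment: "X \<in> indep M \<Longrightarrow> Y \<in> indep M \<Longrightarrow> card X < card Y \<Longrightarrow>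
    \<exists>y\<in>Y - X. insert y X \<in> indep M"
  using M unfolding matroid_def by (blast, blast, blast, blast, blast)

lemma indep_finite: "X \<in> indep M \<Longrightarrow> finite X"
  using finite_subset[OF indep_subset_ground finite_ground] .

lemma finite_indep_subsets: "finite {X \<in> indep M. X \<subseteq> A}"
  using finite_ground indep_subset_ground by (auto intro: finite_subset[of _ "Pow (ground M)"])

lemma card_le_rk: "X \<in> indep M \<Longrightarrow> X \<subseteq> A \<Longrightarrow> card X \<le> rk M A"
  unfolding rk_def using finite_indep_subsets by (intro Max_ge) auto

lemma rk_attained: "\<exists>X\<in>indep M. X \<subseteq> A \<and> card X = rk M A"
proof -
  have "rk M A \<in> card ` {X \<in> indep M. X \<subseteq> A}"
    unfolding rk_def using finite_indep_subsets empty_indep by (intro Max_in) auto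
  then show ?thesis by auto
qed

lemma rk_mono: "A \<subseteq> B \<Longrightarrow> rk M A \<le> rk M B"
  using rk_attained[of A] card_le_rk[of _ B] order_trans by metis

lemma rk_le_card: "finite A \<Longrightarrow> rk M A \<le> card A"
  using rk_attained[of A] card_mono[of A] by metis

lemma rk_indep: "X \<in> indep M \<Longrightarrow> rk M X = card X"
  using card_le_rk[of X X] rk_le_card[of X] indep_finite[of X] by auto

lemma indep_iff_rk: "A \<subseteq> ground M \<Longrightarrow> A \<in> indep M \<longleftrightarrow> rk M A = card A"
  using rk_attained[of A] rk_indep[of A] card_subset_eq[OF finite_subset[OF _ finite_ground]] by metis

lemma rk_empty: "rk M {} = 0"
  using rk_le_card[of "{}"] by simp

lemma indep_extend:
  assumes "I \<in> indep M" "I \<subseteq> A"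
  shows "\<exists>J\<in>indep M. I \<subseteq> J \<and> J \<subseteq> A \<and> card J = rk M A"
  using assms
proof (induction "rk M A - card I" arbitrary: I)
  case 0
  then have "card I = rk M A" using card_le_rk[of I A] by linarith
  then show ?case using 0(2,3) by blast
next
  case (Suc k)
  obtain K where K: "K \<in> indep M" "K \<subseteq> A" "card K = rk M A" using rk_attained by blast
  have "card I < card K" using K Suc(2) by linarith
  then obtain y where y: "y \<in> K - I" "insert y I \<in> indep M"
    using indep_augment[OF Suc(3) K(1)] by blast
  have "card (insert y I) = Suc (card I)"
    using y indep_finite[OF Suc(3)] by simp
  then have "k = rk M A - card (insert y I)" "insert y I \<subseteq> A" using Suc(2,4) y K by auto
  from Suc(1)[OF this(1) y(2) this(2)] show ?case by blast
qed

text \<open>Submodularity in the form used throughout. A largest independent subset I of A extends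
  to a largest one J of B; if e raised the rank of B, augmentation would add e to J, hence to I,
  inside \<open>insert e A\<close>, whose rank has no room for it.\<close>

lemma rk_insert_mono:
  assumes "rk M (insert e A) = rk M A" "A \<subseteq> B"
  shows "rk M (insert e B) = rk M B"
proof (rule ccontr)
  assume "rk M (insert e B) \<noteq> rk M B"
  then have less: "rk M B < rk M (insert e B)" using rk_mono[OF subset_insertI, of B e] by linarith
  obtain I where I: "I \<in> indep M" "I \<subseteq> A" "card I = rk M A" using rk_attained by blast
  then obtain J where J: "J \<in> indep M" "I \<subseteq> J" "J \<subseteq> B" "card J = rk M B"
    using indep_extend[of I B] assms by auto
  obtain K where K: "K \<in> indep M" "K \<subseteq> insert e B" "card K = rk M (insert e B)"
    using rk_attained by blast
  obtain y where y: "y \<in> K - J" "insert y J \<in> indep M" using indep_augment[OF J(1) K(1)] K J less by auto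
  have "y \<notin> B"
  proof
    assume "y \<in> B"
    then have "card (insert y J) \<le> rk M B" using card_le_rk[OF y(2)] J by auto
    then show False using y J indep_finite[OF J(1)] by simp
  qed
  then have "y = e" using y K by auto
  then have "insert e I \<in> indep M" using y(2) indep_subset J(2) by blast
  then have "card (insert e I) \<le> rk M A" using card_le_rk[of "insert e I" "insert e A"] I assms by auto
  moreover have "e \<notin> I" using \<open>y = e\<close> \<open>y \<notin> B\<close> I assms by auto
  ultimately show False using I indep_finite[OF I(1)] by simp
qed

lemma rk_Un_eq:
  assumes "finite B" "\<And>e. e \<in> B \<Longrightarrow> rk M (insert e A) = rk M A"
  shows "rk M (A \<union> B) = rk M A"
  using assms
proof (induction B)
  case (insert b B)
  have "rk M (insert b (A \<union> B)) = rk M (A \<union> B)" using rk_insert_mono[of b A] insert by auto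
  then show ?case using insert by auto
qed simp

lemma rk_insert_le: "rk M (insert e A) \<le> Suc (rk M A)"
proof -
  obtain K where K: "K \<in> indep M" "K \<subseteq> insert e A" "card K = rk M (insert e A)"
    using rk_attained by blast
  have "K - {e} \<in> indep M" "K - {e} \<subseteq> A" using K indep_subset by auto
  then have "card (K - {e}) \<le> rk M A" by (rule card_le_rk)
  then show ?thesis using K(3) indep_finite[OF K(1)] by (metis card_Diff_singleton_if le_SucI le_diff_conv Suc_eq_plus1)
qed

section \<open>Closure and flats\<close>

lemma subset_closure: "A \<subseteq> ground M \<Longrightarrow> A \<subseteq> closure M A"
  by (auto simp: closure_def insert_absorb)

lemma rk_closure:
  assumes "A \<subseteq> ground M"
  shows "rk M (closure M A) = rk M A"
proof -
  have "rk M (A \<union> closure M A) = rk M A"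
    using finite_ground by (intro rk_Un_eq) (auto simp: closure_def)
  then show ?thesis using Un_absorb1[OF subset_closure[OF assms]] by simp
qed

lemma flat_closure:
  assumes "A \<subseteq> ground M"
  shows "flat M (closure M A)"
  unfolding flat_def
proof safe
  fix e assume e: "e \<in> closure M A" then show "e \<in> ground M" by (simp add: closure_def)
next
  fix e assume e: "e \<in> ground M" "e \<notin> closure M A"
  have "rk M (insert e A) \<le> rk M (insert e (closure M A))"
    using subset_closure[OF assms] by (intro rk_mono) auto
  moreover have "rk M A < rk M (insert e A)"
    using e rk_mono[OF subset_insertI, of A e] by (auto simp: closure_def le_less)
  ultimately show "rk M (closure M A) < rk M (insert e (closure M A))"
    using rk_closure[OF assms] by simp
qed

lemma closure_subset_flat:
  assumes "A \<subseteq> F" "flat M F"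
  shows "closure M A \<subseteq> F"
proof
  fix e assume e: "e \<in> closure M A"
  then have "rk M (insert e F) = rk M F" using rk_insert_mono[of e A F] assms by (auto simp: closure_def)
  then show "e \<in> F" using e assms unfolding closure_def flat_def by (metis (no_types, lifting) Diff_iff less_irrefl mem_Collect_eq)
qed

lemma closure_eq_ground_iff:
  assumes "A \<subseteq> ground M"
  shows "closure M A = ground M \<longleftrightarrow> rk M A = rank M"
proof
  assume "closure M A = ground M" then show "rk M A = rank M" using rk_closure[OF assms] by simp
next
  assume *: "rk M A = rank M"
  have "rk M (insert e A) = rk M A" if "e \<in> ground M" for e
    using rk_mono[OF subset_insertI, of A e] rk_mono[of "insert e A" "ground M"] that assms * by auto
  then show "closure M A = ground M" by (auto simp: closure_def)
qed

lemma flat_ground: "flat M (ground M)"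
  by (simp add: flat_def)

section \<open>Restriction and contraction\<close>

lemma rk_restrict: "B \<subseteq> A \<Longrightarrow> rk (restrict M A) B = rk M B"
  unfolding rk_def restrict_def by (rule arg_cong[of _ _ "\<lambda>S. Max (card ` S)"]) auto

lemma matroid_restrict:
  assumes "A \<subseteq> ground M"
  shows "matroid (restrict M A)"
  unfolding matroid_def
proof (intro conjI ballI impI allI)
  show "finite (ground (restrict M A))" using assms finite_ground by (auto simp: restrict_def finite_subset)
  fix X Y assume "X \<in> indep (restrict M A)" "Y \<in> indep (restrict M A)" "card X < card Y"
  then show "\<exists>y\<in>Y - X. insert y X \<in> indep (restrict M A)"
    using indep_augment[of X Y] by (auto simp: restrict_def)
next
  fix X Y assume "X \<in> indep (restrict M A)" "Y \<subseteq> X"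
  then show "Y \<in> indep (restrict M A)" using indep_subset[of X Y] by (auto simp: restrict_def)
qed (use empty_indep in \<open>auto simp: restrict_def\<close>)

lemma loopless_restrict: "loopless M \<Longrightarrow> A \<subseteq> ground M \<Longrightarrow> loopless (restrict M A)"
  by (auto simp: loopless_def restrict_def)

text \<open>Extend a largest independent subset I of A to a largest one J of
  \<open>X \<union> A\<close>. Since I is already maximal in A, J meets A exactly in I, so
  \<open>J - A\<close> realizes the rank in the contraction. The additive form avoids truncated
  subtraction.\<close>

lemma rk_contract:
  assumes "A \<subseteq> ground M" "X \<subseteq> ground M - A"
  shows "rk (contract M A) X + rk M A = rk M (X \<union> A)"
proof -
  let ?S = "{Y \<in> indep (contract M A). Y \<subseteq> X}"
  obtain I where I: "I \<in> indep M" "I \<subseteq> A" "card I = rk M A" using rk_attained by blast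
  obtain J where J: "J \<in> indep M" "I \<subseteq> J" "J \<subseteq> X \<union> A" "card J = rk M (X \<union> A)"
    using indep_extend[of I "X \<union> A"] I by auto
  have "J \<inter> A \<in> indep M" using J indep_subset by blast
  then have "card (J \<inter> A) \<le> card I" using card_le_rk[of "J \<inter> A" A] I by auto
  then have "J \<inter> A = I" using I J indep_finite[OF J(1)] card_seteq[of "J \<inter> A" I] by auto
  then have cJ: "card J = card (J - A) + rk M A"
    using I(3) indep_finite[OF J(1)] card_Int_Diff[of J A] by simp
  have "rk M (J - A \<union> A) = rk M (X \<union> A)"
    using card_le_rk[of J "J - A \<union> A"] J rk_mono[of "J - A \<union> A" "X \<union> A"] by auto
  then have mem: "J - A \<in> ?S" using J cJ assms by (auto simp: contract_def)
  have fin: "finite ?S"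
    using finite_ground by (auto simp: contract_def intro: finite_subset[of _ "Pow (ground M)"])
  have "card Y \<le> card (J - A)" if "Y \<in> ?S" for Y
    using that rk_mono[of "Y \<union> A" "X \<union> A"] cJ J by (auto simp: contract_def)
  then have "rk (contract M A) X = card (J - A)"
    unfolding rk_def using mem fin by (intro Max_eqI) auto
  then show ?thesis using cJ J by simp
qed

text \<open>Heredity: each element raises the rank by at most one, so a set that attains the full
  increase over A has only subsets that do so. Augmentation: if no element of Y raised the rank of
  \<open>X \<union> A\<close>, then Y as a whole would not, and Y could not be larger than
  X.\<close>

lemma matroid_contract:
  assumes "A \<subseteq> ground M"
  shows "matroid (contract M A)"
  unfolding matroid_def
proof (intro conjI ballI impI allI)
  show "finite (ground (contract M A))" using finite_ground by (simp add: contract_def)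
  show "indep (contract M A) \<subseteq> Pow (ground (contract M A))" "{} \<in> indep (contract M A)"
    by (auto simp: contract_def)
next
  fix X Y assume X: "X \<in> indep (contract M A)" and "Y \<subseteq> X"
  have fX: "finite X" using X finite_ground by (auto simp: contract_def finite_subset)
  have sub: "rk M (B \<union> Z) \<le> rk M Z + card B" if "finite B" for B Z
    using that
  proof (induction B)
    case (insert b B)
    then show ?case using rk_insert_le[of b "B \<union> Z"] by auto
  qed simp
  have "X - Y \<union> (Y \<union> A) = X \<union> A" using \<open>Y \<subseteq> X\<close> by auto
  then have "rk M (X \<union> A) \<le> rk M (Y \<union> A) + card (X - Y)" "rk M (Y \<union> A) \<le> rk M A + card Y"
    using sub[of "X - Y" "Y \<union> A"] sub[of Y A] \<open>Y \<subseteq> X\<close> fX finite_subset by auto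
  moreover have "card (X - Y) + card Y = card X"
    using \<open>Y \<subseteq> X\<close> fX by (simp add: card_Diff_subset card_mono finite_subset)
  ultimately show "Y \<in> indep (contract M A)" using X \<open>Y \<subseteq> X\<close> by (auto simp: contract_def)
next
  fix X Y assume X: "X \<in> indep (contract M A)" and Y: "Y \<in> indep (contract M A)" and "card X < card Y"
  have fin: "finite X" "finite Y" using X Y finite_ground by (auto simp: contract_def finite_subset)
  have "\<exists>y\<in>Y. rk M (insert y (X \<union> A)) \<noteq> rk M (X \<union> A)"
  proof (rule ccontr)
    assume "\<not> ?thesis"
    then have "rk M (X \<union> A \<union> Y) = rk M (X \<union> A)" using rk_Un_eq[of Y "X \<union> A"] fin by auto
    then show False using X Y \<open>card X < card Y\<close> rk_mono[of "Y \<union> A" "X \<union> A \<union> Y"]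
      by (auto simp: contract_def)
  qed
  then obtain y where y: "y \<in> Y" "rk M (insert y (X \<union> A)) \<noteq> rk M (X \<union> A)" by blast
  then have "y \<notin> X" by (metis insert_absorb Un_iff)
  moreover have "rk M (insert y (X \<union> A)) = Suc (rk M (X \<union> A))"
    using y rk_insert_le[of y "X \<union> A"] rk_mono[OF subset_insertI, of "X \<union> A" y] by linarith
  ultimately show "\<exists>y\<in>Y - X. insert y X \<in> indep (contract M A)"
    using X Y y fin by (intro bexI[of _ y]) (auto simp: contract_def)
qed

lemma loopless_contract:
  assumes "flat M F"
  shows "loopless (contract M F)"
  unfolding loopless_def
proof
  fix e assume e: "e \<in> ground (contract M F)"
  then have "rk M (insert e F) = Suc (rk M F)"
    using assms rk_insert_le[of e F] by (auto simp: flat_def contract_def le_Suc_eq dest!: bspec[of _ _ e])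
  then show "{e} \<in> indep (contract M F)" using e by (auto simp: contract_def)
qed

end

section \<open>Moebius values and inverse Kazhdan--Lusztig polynomials\<close>

lemma sum_Pow_power_card:
  fixes x :: "'b :: comm_semiring_1"
  assumes "finite A"
  shows "(\<Sum>B\<in>Pow A. x ^ card B) = (1 + x) ^ card A"
  using assms
proof (induction A rule: finite_induct)
  case (insert a A)
  have "(\<Sum>B\<in>Pow (insert a A). x ^ card B) =
      (\<Sum>B\<in>Pow A. x ^ card B) + (\<Sum>B\<in>insert a ` Pow A. x ^ card B)"
    unfolding Pow_insert using insert by (intro sum.union_disjoint) auto
  also have "(\<Sum>B\<in>insert a ` Pow A. x ^ card B) = (\<Sum>B\<in>Pow A. x ^ card (insert a B))"
    using insert by (intro sum.reindex_cong[of "insert a"]) (auto simp: inj_on_def)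
  also have "\<dots> = (\<Sum>B\<in>Pow A. x * x ^ card B)"
  proof (rule sum.cong)
    fix B assume "B \<in> Pow A"
    then have "a \<notin> B" "finite B" using insert finite_subset by auto
    then show "x ^ card (insert a B) = x * x ^ card B" by simp
  qed simp
  finally show ?case using insert by (simp add: sum_distrib_left[symmetric] algebra_simps)
qed simp

lemma sum_Pow_neg_one:
  assumes "finite A"
  shows "(\<Sum>B\<in>Pow A. (-1) ^ card B) = (if A = {} then 1 else 0 :: int)"
  using sum_Pow_power_card[OF assms, of "-1 :: int"] assms by (simp add: power_0_left)

lemma finite_flats: "matroid M \<Longrightarrow> finite {F. flat M F}"
  by (rule finite_subset[of _ "Pow (ground M)"]) (auto simp: flat_def finite_ground)

text \<open>The subsets of a flat G are sorted by their closure, a flat inside G, and their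
  alternating sum vanishes unless G is empty. Hence the sums over closure classes obey the recursion
  that defines the Moebius function.\<close>

lemma moebius_eq_sum_closure:
  assumes M: "matroid M" "loopless M" and G: "flat M G"
  shows "moebius {F. flat M F} {} G = (\<Sum>B | B \<subseteq> ground M \<and> closure M B = G. (-1) ^ card B)"
  using G
proof (induction "card G" arbitrary: G rule: less_induct)
  case less
  let ?g = "\<lambda>F. (\<Sum>B | B \<subseteq> ground M \<and> closure M B = F. (-1) ^ card B) :: int"
  have G: "G \<subseteq> ground M" "finite G" using less(2) finite_ground[OF M(1)] by (auto simp: flat_def finite_subset)
  have fin: "finite {B. B \<subseteq> ground M \<and> P B}" for P
    using finite_ground[OF M(1)] by (auto intro: finite_subset[of _ "Pow (ground M)"])
  have finL: "finite {D. flat M D \<and> P D}" for P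
    using finite_flats[OF M(1)] by (auto intro: finite_subset[of _ "{F. flat M F}"])
  have UN: "Pow G = (\<Union>D\<in>{D. flat M D \<and> D \<subseteq> G}. {B. B \<subseteq> ground M \<and> closure M B = D})"
  proof (intro equalityI subsetI)
    fix B assume "B \<in> Pow G"
    then have "B \<subseteq> G" "B \<subseteq> ground M" using G by auto
    then have "flat M (closure M B)" "closure M B \<subseteq> G"
      using closure_subset_flat[OF M(1) _ less(2)] flat_closure[OF M(1)] by blast+
    then show "B \<in> (\<Union>D\<in>{D. flat M D \<and> D \<subseteq> G}. {B. B \<subseteq> ground M \<and> closure M B = D})"
      using \<open>B \<subseteq> ground M\<close> by blast
  next
    fix B assume "B \<in> (\<Union>D\<in>{D. flat M D \<and> D \<subseteq> G}. {B. B \<subseteq> ground M \<and> closure M B = D})"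
    then have "B \<subseteq> ground M" "closure M B \<subseteq> G" by auto
    then show "B \<in> Pow G" using subset_closure[OF M(1)] by blast
  qed
  have "(\<Sum>B\<in>Pow G. (-1) ^ card B) = (\<Sum>D | flat M D \<and> D \<subseteq> G. ?g D)"
    unfolding UN by (rule sum.UNION_disjoint) (use fin finL in auto)
  also have "{D. flat M D \<and> D \<subseteq> G} = insert G {D. flat M D \<and> D \<subset> G}" using less(2) by auto
  also have "(\<Sum>D\<in>insert G {D. flat M D \<and> D \<subset> G}. ?g D) = ?g G + (\<Sum>D | flat M D \<and> D \<subset> G. ?g D)"
    using finL by (subst sum.insert) auto
  also have "(\<Sum>D | flat M D \<and> D \<subset> G. ?g D) = (\<Sum>D | flat M D \<and> D \<subset> G. moebius {F. flat M F} {} D)"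
    using G by (intro sum.cong refl less(1)[symmetric] psubset_card_mono) auto
  finally have *: "?g G = (if G = {} then 1 else 0) - (\<Sum>D | flat M D \<and> D \<subset> G. moebius {F. flat M F} {} D)"
    using sum_Pow_neg_one[OF G(2)] by simp
  show ?case
  proof (cases "G = {}")
    case True
    then show ?thesis using * by (simp add: moebius.simps)
  next
    case False
    then have "moebius {F. flat M F} {} G = - (\<Sum>D\<in>{D \<in> {F. flat M F}. {} \<subseteq> D \<and> D \<subset> G}. moebius {F. flat M F} {} D)"
      using G by (subst moebius.simps) auto
    then show ?thesis using * False by simp
  qed
qed

lemma mu_eq_sum_spanning:
  assumes "matroid M" "loopless M"
  shows "mu M = (\<Sum>B | B \<subseteq> ground M \<and> rk M B = rank M. (-1) ^ card B)"
proof -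
  have "{B. B \<subseteq> ground M \<and> closure M B = ground M} = {B. B \<subseteq> ground M \<and> rk M B = rank M}"
    using closure_eq_ground_iff[OF assms(1)] by auto
  then show ?thesis unfolding mu_def using moebius_eq_sum_closure[OF assms flat_ground[OF assms(1)]] by simp
qed

text \<open>For T the complement of a flat F this is Whitney's sum for the contraction by F, with a
  spanning set B replaced by its complement X in T. The exponent has the parity of
  \<open>card B\<close>. X thus ranges over the sets that can be removed from M without loss of
  rank.\<close>

definition spanning_sum :: "'a indep_system \<Rightarrow> 'a set \<Rightarrow> int" where
  "spanning_sum M T = (\<Sum>X | X \<subseteq> T \<and> rk M (ground M - X) = rank M. (-1) ^ (card T + card X))"

lemma mu_contract:
  assumes M: "matroid M" and F: "flat M F"
  shows "mu (contract M F) = spanning_sum M (ground M - F)"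
proof -
  let ?E = "ground M"
  have FE: "F \<subseteq> ?E" and fin: "finite ?E" using F finite_ground[OF M] by (auto simp: flat_def)
  have gr: "ground (contract M F) = ?E - F" by (simp add: contract_def)
  have rkc: "rk (contract M F) B = rank (contract M F) \<longleftrightarrow> rk M (B \<union> F) = rank M" if "B \<subseteq> ?E - F" for B
    using rk_contract[OF M FE that] rk_contract[OF M FE, of "?E - F"] FE
    by (simp add: gr Un_absorb2) linarith
  have "mu (contract M F) = (\<Sum>B | B \<subseteq> ?E - F \<and> rk M (B \<union> F) = rank M. (-1) ^ card B)"
    using mu_eq_sum_spanning[OF matroid_contract[OF M FE] loopless_contract[OF M F]] rkc
    unfolding gr by (simp cong: conj_cong)
  also have "\<dots> = spanning_sum M (?E - F)"
    unfolding spanning_sum_def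
  proof (rule sum.reindex_bij_witness[of _ "\<lambda>X. ?E - F - X" "\<lambda>B. ?E - F - B"])
    fix B assume B: "B \<in> {B. B \<subseteq> ?E - F \<and> rk M (B \<union> F) = rank M}"
    have "card B + card (?E - F - B) = card (?E - F)"
      using B fin card_Diff_subset[of B "?E - F"] card_mono[of "?E - F" B] finite_subset[of B ?E]
      by (metis (no_types, lifting) Diff_subset finite_Diff finite_subset le_add_diff_inverse mem_Collect_eq)
    then have "card (?E - F) + card (?E - F - B) = card B + 2 * card (?E - F - B)" by linarith
    then show "(-1) ^ (card (?E - F) + card (?E - F - B)) = ((-1) ^ card B :: int)"
      by (simp add: power_add)
    have "?E - (?E - F - B) = B \<union> F" using B FE by auto
    then show "?E - F - B \<in> {X. X \<subseteq> ?E - F \<and> rk M (?E - X) = rank M}" using B by auto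
  next
    fix X assume X: "X \<in> {X. X \<subseteq> ?E - F \<and> rk M (?E - X) = rank M}"
    then have "?E - F - X \<union> F = ?E - X" using FE by auto
    then show "?E - F - X \<in> {B. B \<subseteq> ?E - F \<and> rk M (B \<union> F) = rank M}" using X by auto
  qed auto
  finally show ?thesis .
qed

text \<open>If \<open>e\<close> lies in the closure of the complement of \<open>T\<close>, toggling \<open>e\<close> is a sign-reversing involution.\<close>

lemma spanning_sum_nonflat:
  assumes M: "matroid M" and T: "T \<subseteq> ground M" and nf: "\<not> flat M (ground M - T)"
  shows "spanning_sum M T = 0"
proof -
  let ?E = "ground M"
  have fin: "finite ?E" using finite_ground[OF M] .
  obtain e where e: "e \<in> T" "rk M (insert e (?E - T)) = rk M (?E - T)"
  proof -
    from nf obtain e where "e \<in> ?E - (?E - T)" "\<not> rk M (?E - T) < rk M (insert e (?E - T))"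
      unfolding flat_def by blast
    then have "e \<in> T" "rk M (insert e (?E - T)) = rk M (?E - T)"
      using rk_mono[OF M subset_insertI[of "?E - T" e]] by (blast, linarith)
    then show ?thesis by (rule that)
  qed
  let ?S = "{X. X \<subseteq> T \<and> rk M (?E - X) = rank M}"
  let ?f = "\<lambda>X. (-1) ^ (card T + card X) :: int"
  have toggle: "rk M (?E - insert e X) = rk M (?E - X)" if "X \<subseteq> T" "e \<notin> X" for X
  proof -
    have "rk M (insert e (?E - insert e X)) = rk M (?E - insert e X)"
      using that e(1) by (intro rk_insert_mono[OF M e(2)]) blast
    moreover have "insert e (?E - insert e X) = ?E - X" using e(1) T that by blast
    ultimately show ?thesis by simp
  qed
  have finS: "finite {X \<in> ?S. P X}" for P
    using fin T by (auto intro!: finite_subset[of _ "Pow ?E"])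
  have split: "?S = {X \<in> ?S. e \<notin> X} \<union> {X \<in> ?S. e \<in> X}" by auto
  have "sum ?f ?S = sum ?f {X \<in> ?S. e \<notin> X} + sum ?f {X \<in> ?S. e \<in> X}"
    by (subst split, rule sum.union_disjoint) (use finS in auto)
  also have "sum ?f {X \<in> ?S. e \<in> X} = (\<Sum>X\<in>{X \<in> ?S. e \<notin> X}. - ?f X)"
  proof (rule sum.reindex_bij_witness[of _ "insert e" "\<lambda>X. X - {e}"])
    fix X assume X: "X \<in> {X \<in> ?S. e \<in> X}"
    have "insert e (X - {e}) = X" using X by auto
    moreover have "X - {e} \<subseteq> T" using X by blast
    ultimately show "X - {e} \<in> {X \<in> ?S. e \<notin> X}" using X toggle[of "X - {e}"] by simp
    show "insert e (X - {e}) = X" by fact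
    have "finite X" using X T fin by (auto intro: finite_subset)
    then have "card X = Suc (card (X - {e}))" using X by (intro card.remove) auto
    then show "- ?f (X - {e}) = ?f X" by simp
  next
    fix X assume "X \<in> {X \<in> ?S. e \<notin> X}"
    then show "insert e X \<in> {X \<in> ?S. e \<in> X}" "insert e X - {e} = X" using e(1) toggle[of X] by auto
  qed
  finally show ?thesis by (simp add: spanning_sum_def sum_negf)
qed

section \<open>The inverse Z-polynomial as a sum over all subsets\<close>

definition inv_Z_term :: "('a indep_system \<Rightarrow> int poly) \<Rightarrow> 'a indep_system \<Rightarrow> 'a set \<Rightarrow> int poly" where
  "inv_Z_term Q M T = monom ((-1) ^ (rank M - rk M (ground M - T)) * spanning_sum M T)
    (rank M - rk M (ground M - T)) * Q (restrict M (ground M - T))"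

text \<open>The index set becomes a full power set, so that later evaluations are binomial
  sums.\<close>

lemma inv_Z_sum_eq_sum_Pow:
  assumes M: "matroid M"
  shows "inv_Z_sum Q M = (\<Sum>T\<in>Pow (ground M). inv_Z_term Q M T)"
proof -
  let ?E = "ground M"
  have "inv_Z_sum Q M = (\<Sum>T | T \<subseteq> ?E \<and> flat M (?E - T). inv_Z_term Q M T)"
    unfolding inv_Z_sum_def
  proof (rule sum.reindex_bij_witness[of _ "\<lambda>T. ?E - T" "\<lambda>F. ?E - F"])
    fix F assume F: "F \<in> {F. flat M F}"
    then have "?E - (?E - F) = F" by (auto simp: flat_def)
    then show "?E - (?E - F) = F" "?E - F \<in> {T. T \<subseteq> ?E \<and> flat M (?E - T)}"
      "inv_Z_term Q M (?E - F) =
        monom ((-1) ^ (rank M - rk M F) * mu (contract M F)) (rank M - rk M F) * Q (restrict M F)"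
      using F mu_contract[OF M, of F] by (auto simp: inv_Z_term_def)
  qed auto
  also have "\<dots> = (\<Sum>T\<in>Pow ?E. inv_Z_term Q M T)"
    using finite_ground[OF M] spanning_sum_nonflat[OF M]
    by (intro sum.mono_neutral_left) (auto simp: inv_Z_term_def)
  finally show ?thesis .
qed

section \<open>Truncation: the low-degree solution of the palindromicity condition\<close>

definition trunc :: "nat \<Rightarrow> int poly \<Rightarrow> int poly" where
  "trunc d R = (\<Sum>i\<in>{i. 2 * i < d}. monom (coeff R (d - i) - coeff R i) i)"

text \<open>Stated by coefficients because of d = 0: there it means p = 0, the value wanted for a
  loop, whereas \<open>2 * degree p < 0\<close> never holds. This also makes it multiplicative
  without exceptions.\<close>

definition low :: "nat \<Rightarrow> int poly \<Rightarrow> bool" where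
  "low d p \<longleftrightarrow> (\<forall>i. d \<le> 2 * i \<longrightarrow> coeff p i = 0)"

lemma coeff_trunc: "coeff (trunc d R) i = (if 2 * i < d then coeff R (d - i) - coeff R i else 0)"
proof -
  have "finite {i. 2 * i < d}" by (rule finite_subset[of _ "{..<d}"]) auto
  then show ?thesis by (auto simp: trunc_def coeff_sum)
qed

lemma low_trunc: "low d (trunc d R)"
  by (auto simp: low_def coeff_trunc)

lemma palindromic_trunc:
  assumes "degree R \<le> d"
  shows "palindromic d (trunc d R + R)"
  unfolding palindromic_def
proof (intro conjI allI impI)
  have "degree (trunc d R) \<le> d" by (rule degree_le) (auto simp: coeff_trunc)
  then show "degree (trunc d R + R) \<le> d" using assms by (rule degree_add_le)
  fix i assume "i \<le> d"
  show "coeff (trunc d R + R) i = coeff (trunc d R + R) (d - i)"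
  proof (cases "2 * i = d")
    case True
    then have "d - i = i" by simp
    then show ?thesis by simp
  qed (use \<open>i \<le> d\<close> in \<open>auto simp: coeff_trunc\<close>)
qed

text \<open>For 2 i < d the polynomial p contributes to coefficient i of \<open>p + R\<close> but
  not to coefficient d - i, so palindromicity reads p_i + R_i = R_(d - i). This is where the formula
  of \<open>trunc\<close> comes from.\<close>

lemma trunc_unique:
  assumes "low d p" "palindromic d (p + R)"
  shows "p = trunc d R"
proof (rule poly_eqI)
  fix i show "coeff p i = coeff (trunc d R) i"
  proof (cases "2 * i < d")
    case True
    then have "coeff p (d - i) = 0" using assms(1) by (auto simp: low_def)
    moreover have "coeff (p + R) i = coeff (p + R) (d - i)"
      using assms(2) True unfolding palindromic_def by (elim conjE allE[of _ i]) linarith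
    ultimately show ?thesis using True by (simp add: coeff_trunc)
  qed (use assms(1) in \<open>auto simp: low_def coeff_trunc\<close>)
qed

lemma trunc_0 [simp]: "trunc 0 R = 0" "trunc d 0 = 0"
  by (auto simp: poly_eq_iff coeff_trunc)

lemma trunc_add: "trunc d (p + q) = trunc d p + trunc d q"
  by (rule poly_eqI) (auto simp: coeff_trunc)

lemma low_iff_degree: "0 < d \<Longrightarrow> low d p \<longleftrightarrow> 2 * degree p < d"
proof
  assume "0 < d" "low d p"
  show "2 * degree p < d"
  proof (rule ccontr)
    assume "\<not> 2 * degree p < d"
    then have "p = 0" using \<open>low d p\<close> unfolding low_def by (metis leading_coeff_0_iff not_le)
    then show False using \<open>\<not> 2 * degree p < d\<close> \<open>0 < d\<close> by simp
  qed
qed (auto simp: low_def intro: coeff_eq_0)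

section \<open>Existence and uniqueness of the inverse Kazhdan--Lusztig polynomial\<close>

function kl :: "'a indep_system \<Rightarrow> int poly" where
  "kl N = (if matroid N \<and> loopless N then
      if rank N = 0 then 1
      else trunc (rank N) (\<Sum>F\<in>{F. flat N F \<and> F \<noteq> ground N}.
        monom ((-1) ^ (rank N - rk N F) * mu (contract N F)) (rank N - rk N F) * kl (restrict N F))
    else 0)"
  by auto
termination
  by (relation "measure (\<lambda>N. card (ground N))")
    (auto simp: restrict_def flat_def intro!: psubset_card_mono finite_ground)

declare kl.simps [simp del]

lemma restrict_ground: "matroid N \<Longrightarrow> restrict N (ground N) = N"
  using indep_subset_ground[of N] by (cases N) (auto simp: restrict_def)

lemma mu_contract_ground: "matroid N \<Longrightarrow> mu (contract N (ground N)) = 1"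
  by (simp add: mu_def contract_def moebius.simps)

lemma inv_Z_sum_split:
  assumes "matroid N"
  shows "inv_Z_sum Q N = Q N + (\<Sum>F\<in>{F. flat N F \<and> F \<noteq> ground N}.
    monom ((-1) ^ (rank N - rk N F) * mu (contract N F)) (rank N - rk N F) * Q (restrict N F))"
proof -
  have "{F. flat N F} = insert (ground N) {F. flat N F \<and> F \<noteq> ground N}"
    using flat_ground[OF assms] by auto
  moreover have "finite {F. flat N F \<and> F \<noteq> ground N}"
    using finite_flats[OF assms] by (auto intro: finite_subset)
  ultimately show ?thesis unfolding inv_Z_sum_def
    using assms by (simp add: restrict_ground mu_contract_ground)
qed

lemma rank_0_loopless:
  assumes "matroid N" "loopless N" "rank N = 0"
  shows "ground N = {}"
  using card_le_rk[OF assms(1), of "{_}" "ground N"] assms by (fastforce simp: loopless_def)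

text \<open>The definite description \<open>inv_KL\<close> says nothing until a solution is
  exhibited. In the sum over flats the whole ground set contributes the unknown value itself, and
  \<open>kl\<close> solves for it by truncating the contribution of the proper flats.\<close>

lemma is_inv_KL_kl: "is_inv_KL kl"
proof -
  have "(rank N = 0 \<longrightarrow> kl N = 1) \<and> (rank N > 0 \<longrightarrow> 2 * degree (kl N) < rank N) \<and>
      palindromic (rank N) (inv_Z_sum kl N)" if "matroid N" "loopless N" for N :: "'a indep_system"
    using that
  proof (induction "card (ground N)" arbitrary: N rule: less_induct)
    case less
    note N = less(2,3)
    let ?R = "\<Sum>F\<in>{F. flat N F \<and> F \<noteq> ground N}.
        monom ((-1) ^ (rank N - rk N F) * mu (contract N F)) (rank N - rk N F) * kl (restrict N F)"
    show ?case
    proof (cases "rank N = 0")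
      case True
      then have "ground N = {}" using rank_0_loopless N by blast
      then have "{F. flat N F \<and> F \<noteq> ground N} = {}" by (auto simp: flat_def)
      then have "inv_Z_sum kl N = kl N" using inv_Z_sum_split[OF N(1), of kl] by (simp only: sum.empty add_0_right)
      then show ?thesis using True N by (simp add: kl.simps palindromic_def)
    next
      case False
      \<comment> \<open>The term of a flat F has degree at most
        \<open>(rank N - rk N F) + rk N F\<close>; the second summand bounds \<open>kl\<close> on
        the restriction by the induction hypothesis.\<close>
      have "degree ?R \<le> rank N"
      proof (rule degree_sum_le)
        show "finite {F. flat N F \<and> F \<noteq> ground N}"
          using finite_flats[OF N(1)] by (auto intro: finite_subset)
        fix F assume F: "F \<in> {F. flat N F \<and> F \<noteq> ground N}"
        then have sub: "F \<subset> ground N" by (auto simp: flat_def)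
        have rF: "rank (restrict N F) = rk N F"
          using rk_restrict[OF N(1), of F F] by (simp add: restrict_def)
        have "card (ground (restrict N F)) < card (ground N)"
          using sub finite_ground[OF N(1)] by (simp add: restrict_def psubset_card_mono)
        then have "degree (kl (restrict N F)) \<le> rk N F"
          using less(1)[of "restrict N F"] matroid_restrict[OF N(1), of F] loopless_restrict[OF N(1,2), of F] sub
          by (cases "rk N F = 0") (auto simp: rF)
        moreover have "degree (monom ((-1) ^ (rank N - rk N F) * mu (contract N F)) (rank N - rk N F))
            \<le> rank N - rk N F" by (rule degree_monom_le)
        moreover have "rk N F \<le> rank N" using sub by (intro rk_mono[OF N(1)]) auto
        ultimately show "degree (monom ((-1) ^ (rank N - rk N F) * mu (contract N F)) (rank N - rk N F) *
            kl (restrict N F)) \<le> rank N"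
          by (intro order_trans[OF degree_mult_le]) linarith
      qed
      moreover have kl: "kl N = trunc (rank N) ?R" using False N by (simp add: kl.simps[of N])
      ultimately have "palindromic (rank N) (inv_Z_sum kl N)"
        using inv_Z_sum_split[OF N(1), of kl] palindromic_trunc by simp
      then show ?thesis using False low_trunc[of "rank N" ?R] low_iff_degree[of "rank N" "kl N"] kl by simp
    qed
  qed
  then show ?thesis unfolding is_inv_KL_def by (auto simp: kl.simps)
qed

lemma is_inv_KL_low: "is_inv_KL Q \<Longrightarrow> matroid N \<Longrightarrow> loopless N \<Longrightarrow> rank N > 0 \<Longrightarrow> low (rank N) (Q N)"
  by (simp add: is_inv_KL_def low_iff_degree)

text \<open>Proper flats have smaller ground sets, so by induction two solutions have the same
  remainder to truncate.\<close>

lemma is_inv_KL_unique: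
  assumes Q: "is_inv_KL Q" and Q': "is_inv_KL Q'"
  shows "Q N = Q' N"
proof (induction "card (ground N)" arbitrary: N rule: less_induct)
  case less
  show ?case
  proof (cases "matroid N \<and> loopless N")
    case False
    then show ?thesis using Q Q' unfolding is_inv_KL_def by metis
  next
    case True
    show ?thesis
    proof (cases "rank N = 0")
      case True
      then show ?thesis using Q Q' \<open>matroid N \<and> _\<close> unfolding is_inv_KL_def by metis
    next
      case False
      let ?R = "\<lambda>Q. \<Sum>F\<in>{F. flat N F \<and> F \<noteq> ground N}.
        monom ((-1) ^ (rank N - rk N F) * mu (contract N F)) (rank N - rk N F) * Q (restrict N F)"
      have "?R Q = ?R Q'"
      proof (intro sum.cong refl arg_cong2[where f = "(*)"] less)
        fix F assume "F \<in> {F. flat N F \<and> F \<noteq> ground N}"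
        then have "F \<subset> ground N" by (auto simp: flat_def)
        then show "card (ground (restrict N F)) < card (ground N)"
          using True finite_ground[of N] by (simp add: restrict_def psubset_card_mono)
      qed
      have "Q'' N = trunc (rank N) (?R Q'')" if "is_inv_KL Q''" for Q''
        using that True False inv_Z_sum_split[of N Q'']
        by (intro trunc_unique is_inv_KL_low) (auto simp: is_inv_KL_def)
      from this[OF Q] this[OF Q'] show ?thesis unfolding \<open>?R Q = ?R Q'\<close> by simp
    qed
  qed
qed

lemma is_inv_KL_inv_KL: "is_inv_KL inv_KL"
  unfolding inv_KL_def using is_inv_KL_kl is_inv_KL_unique by (intro theI[of is_inv_KL kl]) (auto simp: fun_eq_iff)

lemma inv_KL_not_loopless: "\<not> loopless N \<Longrightarrow> inv_KL N = 0"
  using is_inv_KL_inv_KL unfolding is_inv_KL_def by blast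

lemma inv_KL_rank_0: "matroid N \<Longrightarrow> loopless N \<Longrightarrow> rank N = 0 \<Longrightarrow> inv_KL N = 1"
  using is_inv_KL_inv_KL unfolding is_inv_KL_def by blast

lemma inv_KL_eq_trunc:
  assumes "matroid N" "loopless N" "rank N > 0" "inv_Z N = inv_KL N + R"
  shows "inv_KL N = trunc (rank N) R"
  using assms is_inv_KL_inv_KL is_inv_KL_low[OF is_inv_KL_inv_KL]
  by (intro trunc_unique) (auto simp: is_inv_KL_def inv_Z_def)

text \<open>For guessing Q: only the low degree of p and the palindromicity of \<open>p + R\<close>
  remain to be checked.\<close>

lemma inv_KL_eqI:
  assumes "matroid N" "loopless N" "rank N > 0" "inv_Z N = inv_KL N + R" "low (rank N) p"
    "palindromic (rank N) (p + R)"
  shows "inv_KL N = p"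
  using inv_KL_eq_trunc[OF assms(1-4)] trunc_unique[OF assms(5,6)] by simp

lemma inv_Z_not_loopless:
  assumes "matroid N" "\<not> loopless N"
  shows "inv_Z N = 0"
proof -
  obtain e where e: "e \<in> ground N" "{e} \<notin> indep N" using assms(2) by (auto simp: loopless_def)
  have "rk N {e} = rk N {}"
    using indep_iff_rk[OF assms(1), of "{e}"] rk_insert_le[OF assms(1), of e "{}"] e
    by (auto simp: rk_empty[OF assms(1)])
  have "e \<in> F" if "flat N F" for F
    using rk_insert_mono[OF assms(1), of e "{}" F] \<open>rk N {e} = rk N {}\<close> that e(1)
    unfolding flat_def by (metis DiffI empty_subsetI less_irrefl)
  then have "inv_KL (restrict N F) = 0" if "flat N F" for F
    using that e by (intro inv_KL_not_loopless) (auto simp: restrict_def loopless_def)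
  then show ?thesis by (simp add: inv_Z_def inv_Z_sum_def)
qed

section \<open>Polynomial identities\<close>

definition var :: "int poly" where
  "var = monom 1 1"

lemma monom_eq_var: "monom c k = of_int c * var ^ k"
  by (simp add: var_def monom_power of_int_poly smult_monom)

lemma sum_supersets_power_card:
  fixes x :: "'b :: comm_semiring_1"
  assumes "finite A" "D \<subseteq> A"
  shows "(\<Sum>T | D \<subseteq> T \<and> T \<subseteq> A. x ^ (card T - card D)) = (1 + x) ^ (card A - card D)"
proof -
  have fD: "finite D" using assms finite_subset by auto
  have "(\<Sum>T | D \<subseteq> T \<and> T \<subseteq> A. x ^ (card T - card D)) = (\<Sum>B\<in>Pow (A - D). x ^ card B)"
    by (rule sum.reindex_bij_witness[of _ "\<lambda>B. B \<union> D" "\<lambda>T. T - D"])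
      (use assms fD in \<open>auto simp: card_Diff_subset\<close>)
  then show ?thesis using assms fD by (simp add: sum_Pow_power_card card_Diff_subset)
qed

lemma sum_Pow_card:
  fixes f :: "nat \<Rightarrow> 'b :: comm_semiring_1"
  assumes "finite A"
  shows "(\<Sum>T\<in>Pow A. f (card T)) = (\<Sum>k\<le>card A. of_nat (card A choose k) * f k)"
proof -
  have "(\<Sum>T\<in>Pow A. f (card T)) = (\<Sum>k\<le>card A. \<Sum>T\<in>{T \<in> Pow A. card T = k}. f (card T))"
    using assms by (intro sum.group[symmetric]) (auto intro: card_mono)
  also have "\<dots> = (\<Sum>k\<le>card A. of_nat (card A choose k) * f k)"
    using n_subsets[OF assms] by (intro sum.cong) auto
  finally show ?thesis .
qed

text \<open>Formally the derivative of x^(t - 1), cut off to 0 at t = 0; hence the extra 1 in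
  \<open>var2_hterm\<close>. With t = \<open>card T\<close> it serves both kinds of terms: a
  nonempty T inside one block gives \<open>var * hterm t\<close> times the polynomial of a circuit,
  a T in no block gives \<open>- hterm t\<close> plus a count of pairs.\<close>

definition hterm :: "nat \<Rightarrow> int poly" where
  "hterm t = (if t < 2 then 0 else of_nat (t - 1) * var ^ (t - 2))"

text \<open>By the binomial theorem this is the derivative of ((1 + x)^s - 1) / x. Its closed form
  \<open>var2_H\<close> is multiplied by x^2 in order to stay within polynomials.\<close>

definition H :: "nat \<Rightarrow> int poly" where
  "H s = (\<Sum>k\<le>s. of_nat (s choose k) * hterm k)"

lemma sum_hterm: "finite A \<Longrightarrow> (\<Sum>T\<in>Pow A. hterm (card T)) = H (card A)"
  by (simp add: sum_Pow_card H_def)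

lemma H_1: "H (Suc 0) = 0"
  by (simp add: H_def hterm_def)

lemma var_hterm:
  assumes "0 < t"
  shows "var * hterm t = (of_nat t - 1) * var ^ (t - 1)"
proof (cases "t = 1")
  case True
  show ?thesis unfolding True hterm_def by simp
next
  case False
  define k where "k = t - 2"
  have k: "t = Suc (Suc k)" using assms False by (simp add: k_def)
  have "hterm t = of_nat (Suc k) * var ^ k" unfolding k hterm_def by simp
  moreover have "of_nat t - 1 = (of_nat (Suc k) :: int poly)" unfolding k by simp
  moreover have "var ^ (t - 1) = var * var ^ k" unfolding k by simp
  ultimately show ?thesis by (simp only: mult.left_commute)
qed

lemma var2_hterm: "var ^ 2 * hterm t = (of_nat t - 1) * var ^ t + (if t = 0 then 1 else 0)"
proof (cases t)
  case (Suc k)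
  have "var ^ 2 * hterm t = var * (var * hterm t)" by (simp add: power2_eq_square)
  also have "\<dots> = (of_nat t - 1) * var ^ t" using Suc by (simp add: var_hterm del: of_nat_Suc)
  finally show ?thesis using Suc by simp
qed (simp add: hterm_def)

text \<open>Double counting of the pairs of a set T and an element e of it.\<close>

lemma sum_Pow_card_mult_power:
  fixes x :: "'b :: comm_semiring_1"
  assumes "finite A"
  shows "(\<Sum>T\<in>Pow A. of_nat (card T) * x ^ card T) = of_nat (card A) * x * (1 + x) ^ (card A - 1)"
proof -
  have "(\<Sum>T\<in>Pow A. of_nat (card T) * x ^ card T) = (\<Sum>T\<in>Pow A. \<Sum>e\<in>{e\<in>A. e \<in> T}. x ^ card T)"
  proof (rule sum.cong)
    fix T assume "T \<in> Pow A"
    then have "{e\<in>A. e \<in> T} = T" by auto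
    then show "of_nat (card T) * x ^ card T = (\<Sum>e\<in>{e\<in>A. e \<in> T}. x ^ card T)" by simp
  qed simp
  also have "\<dots> = (\<Sum>e\<in>A. \<Sum>T\<in>{T\<in>Pow A. e \<in> T}. x ^ card T)"
    using assms by (intro sum.swap_restrict) auto
  also have "\<dots> = (\<Sum>e\<in>A. x * (1 + x) ^ (card A - 1))"
  proof (rule sum.cong)
    fix e assume e: "e \<in> A"
    have "(\<Sum>T\<in>{T\<in>Pow A. e \<in> T}. x ^ card T) = (\<Sum>T | {e} \<subseteq> T \<and> T \<subseteq> A. x * x ^ (card T - card {e}))"
    proof (rule sum.cong)
      fix T assume T: "T \<in> {T. {e} \<subseteq> T \<and> T \<subseteq> A}"
      then have "card T > 0" using assms finite_subset by (auto simp: card_gt_0_iff)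
      then show "x ^ card T = x * x ^ (card T - card {e})" by (simp flip: power_Suc)
    qed auto
    also have "\<dots> = x * (1 + x) ^ (card A - 1)"
      using sum_supersets_power_card[OF assms, of "{e}" x] e by (simp flip: sum_distrib_left)
    finally show "(\<Sum>T\<in>{T\<in>Pow A. e \<in> T}. x ^ card T) = x * (1 + x) ^ (card A - 1)" .
  qed simp
  finally show ?thesis by (simp add: algebra_simps)
qed

lemma var2_H: "var ^ 2 * H s = of_nat s * var * (1 + var) ^ (s - 1) - (1 + var) ^ s + 1"
proof -
  let ?A = "{..<s}"
  have "var ^ 2 * H s = (\<Sum>T\<in>Pow ?A. var ^ 2 * hterm (card T))"
    using sum_hterm[of ?A] by (simp flip: sum_distrib_left)
  also have "\<dots> = (\<Sum>T\<in>Pow ?A. of_nat (card T) * var ^ card T - var ^ card T + (if T = {} then 1 else 0))"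
  proof (rule sum.cong)
    fix T assume "T \<in> Pow ?A"
    then have "card T = 0 \<longleftrightarrow> T = {}" by (auto simp: finite_subset)
    then show "var ^ 2 * hterm (card T) =
        of_nat (card T) * var ^ card T - var ^ card T + (if T = {} then 1 else 0)"
      unfolding var2_hterm by (simp add: left_diff_distrib)
  qed simp
  also have "\<dots> = of_nat s * var * (1 + var) ^ (s - 1) - (1 + var) ^ s + 1"
    using sum_Pow_card_mult_power[of ?A var] sum_Pow_power_card[of ?A var]
    by (simp add: sum.distrib sum_subtractf)
  finally show ?thesis .
qed

lemma var_nonzero: "var \<noteq> 0"
  by (simp add: var_def)

text \<open>The source of multiplicativity for two blocks: the a * b pairs with one element in each
  block turn a difference of values of \<open>H\<close> into a product.\<close>

lemma H_product:
  assumes "0 < a" "0 < b"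
  shows "of_nat (a * b) * (1 + var) ^ (a + b - 2) - H (a + b) + H a + H b = var ^ 2 * H a * H b"
proof -
  obtain c d where ab: "a = Suc c" "b = Suc d" using assms by (auto simp: gr0_conv_Suc)
  \<comment> \<open>Multiplied by \<open>var ^ 2\<close>, every summand has an explicit form in
    powers of \<open>1 + var\<close>; the factor is cancelled at the end because \<open>var\<close>
    is nonzero.\<close>
  have "var ^ 2 * (of_nat (a * b) * (1 + var) ^ (a + b - 2) - H (a + b) + H a + H b) =
      of_nat (a * b) * (var ^ 2 * (1 + var) ^ (a + b - 2)) - var ^ 2 * H (a + b) + var ^ 2 * H a + var ^ 2 * H b"
    by (simp add: algebra_simps)
  also have "\<dots> = (var ^ 2 * H a) * (var ^ 2 * H b)"
    unfolding var2_H ab by (simp add: power_add algebra_simps power2_eq_square)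
  also have "\<dots> = var ^ 2 * (var ^ 2 * H a * H b)" by (simp add: algebra_simps)
  finally show ?thesis using var_nonzero by simp
qed

text \<open>Coefficient k of the product is indexed by the pairs (j, l) with j + l = k, j at most d
  and l at most e; the degree bounds annihilate all other pairs. On these index sets (j, l) -> (d -
  j, e - l) is a bijection from sum i to sum d + e - i.\<close>

lemma palindromic_mult:
  assumes p: "palindromic d p" and q: "palindromic e q"
  shows "palindromic (d + e) (p * q)"
proof -
  have deg: "degree p \<le> d" "degree q \<le> e" using p q by (auto simp: palindromic_def)
  let ?S = "\<lambda>k. {(j, l). j \<le> d \<and> l \<le> e \<and> j + l = k}"
  have full: "coeff (p * q) k = (\<Sum>(j, l)\<in>?S k. coeff p j * coeff q l)" for k
  proof -
    have "coeff (p * q) k = (\<Sum>j\<le>k. coeff p j * coeff q (k - j))" by (rule coeff_mult)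
    also have "\<dots> = (\<Sum>(j, l) | j + l = k. coeff p j * coeff q l)"
      by (rule sum.reindex_bij_witness[of _ fst "\<lambda>j. (j, k - j)"]) auto
    also have "\<dots> = (\<Sum>(j, l)\<in>?S k. coeff p j * coeff q l)"
    proof (rule sum.mono_neutral_right)
      show "finite {(j, l). j + l = k}" by (rule finite_subset[of _ "{..k} \<times> {..k}"]) auto
      show "\<forall>x\<in>{(j, l). j + l = k} - ?S k. (case x of (j, l) \<Rightarrow> coeff p j * coeff q l) = 0"
        using deg by (auto dest!: le_degree)
    qed auto
    finally show ?thesis .
  qed
  have "coeff (p * q) i = coeff (p * q) (d + e - i)" if i: "i \<le> d + e" for i
    unfolding full
  proof (rule sum.reindex_bij_witness[of _ "\<lambda>(j, l). (d - j, e - l)" "\<lambda>(j, l). (d - j, e - l)"])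
    fix x assume "x \<in> ?S i"
    then obtain j l where x: "x = (j, l)" "j \<le> d" "l \<le> e" "j + l = i" by blast
    then have "coeff p j = coeff p (d - j)" "coeff q l = coeff q (e - l)"
      using p q unfolding palindromic_def by blast+
    then show "(case case x of (j, l) \<Rightarrow> (d - j, e - l) of (j, l) \<Rightarrow> coeff p j * coeff q l) =
      (case x of (j, l) \<Rightarrow> coeff p j * coeff q l)" using x(1) by simp
    show "(case x of (j, l) \<Rightarrow> (d - j, e - l)) \<in> ?S (d + e - i)"
      "(case case x of (j, l) \<Rightarrow> (d - j, e - l) of (j, l) \<Rightarrow> (d - j, e - l)) = x"
      using x by auto
  next
    fix x assume "x \<in> ?S (d + e - i)"
    then show "(case x of (j, l) \<Rightarrow> (d - j, e - l)) \<in> ?S i"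
      "(case case x of (j, l) \<Rightarrow> (d - j, e - l) of (j, l) \<Rightarrow> (d - j, e - l)) = x"
      using i by auto
  qed
  moreover have "degree (p * q) \<le> d + e" using degree_mult_le[of p q] deg by linarith
  ultimately show ?thesis unfolding palindromic_def by blast
qed

lemma palindromic_power_var: "palindromic n ((1 + var) ^ n)"
proof (induction n)
  case (Suc n)
  have "palindromic 1 (1 + var)"
    unfolding palindromic_def var_def
    by (intro conjI degree_add_le) (auto simp: le_Suc_eq degree_monom_eq)
  from palindromic_mult[OF this Suc] show ?case by simp
qed (simp add: palindromic_def)

text \<open>If 2 (j + l) is at least d + e, then 2 j is at least d or 2 l is at least e.\<close>

lemma low_mult:
  assumes "low d p" "low e q"
  shows "low (d + e) (p * q)"
  unfolding low_def
proof (intro allI impI)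
  fix i assume i: "d + e \<le> 2 * i"
  have "coeff p j * coeff q (i - j) = 0" if "j \<le> i" for j
  proof (cases "d \<le> 2 * j")
    case False
    then have "e \<le> 2 * (i - j)" using i by simp
    then show ?thesis using assms(2) by (auto simp: low_def)
  qed (use assms(1) in \<open>auto simp: low_def\<close>)
  then show "coeff (p * q) i = 0" unfolding coeff_mult by (intro sum.neutral) auto
qed

text \<open>The polynomials \<open>qcirc m\<close> and \<open>qcirc m + var * H m\<close> are the inverse Kazhdan--Lusztig and inverse
  Z-polynomials of a circuit of size \<open>m\<close>; a circuit of size 1 is a loop, where both vanish.\<close>

definition qcirc :: "nat \<Rightarrow> int poly" where
  "qcirc m = trunc (m - 1) (var * H m)"

lemma degree_H: "degree (H m) \<le> m - 2"
  unfolding H_def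
proof (rule degree_sum_le)
  fix k assume "k \<in> {..m}"
  have "degree (hterm k) \<le> k - 2"
    by (auto simp: hterm_def var_def monom_power of_nat_poly degree_monom_le intro: order_trans[OF degree_smult_le])
  then show "degree (of_nat (m choose k) * hterm k) \<le> m - 2"
    using \<open>k \<in> {..m}\<close> order_trans[OF degree_smult_le[of _ "hterm k"], of "k - 2"] by (auto simp: of_nat_poly)
qed simp

lemma palindromic_qcirc: "palindromic (m - 1) (qcirc m + var * H m)"
proof (cases "m < 2")
  case True
  then have "H m = 0" by (auto simp: H_def hterm_def intro!: sum.neutral)
  then show ?thesis by (simp add: qcirc_def palindromic_def)
next
  case False
  then have "degree (var * H m) \<le> m - 1"
    using degree_H[of m] degree_mult_le[of var "H m"] degree_monom_le[of "1 :: int" 1] unfolding var_def by linarith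
  then show ?thesis unfolding qcirc_def by (rule palindromic_trunc)
qed

lemma qcirc_1: "qcirc (Suc 0) = 0"
  by (simp add: qcirc_def)

section \<open>Free matroids and circuits\<close>

lemma rk_eqI:
  assumes "matroid M" "I \<in> indep M" "I \<subseteq> A" "card I = k"
    and "\<And>X. X \<in> indep M \<Longrightarrow> X \<subseteq> A \<Longrightarrow> card X \<le> k"
  shows "rk M A = k"
  using card_le_rk[OF assms(1-3)] rk_attained[OF assms(1), of A] assms(4,5) by (metis le_antisym)

text \<open>The empty T is the complement of the whole ground set and contributes Q itself.\<close>

lemma inv_Z_split:
  assumes "matroid N"
  shows "inv_Z N = inv_KL N + (\<Sum>T\<in>Pow (ground N) - {{}}. inv_Z_term inv_KL N T)"
proof -
  have "{X. X \<subseteq> {} \<and> rk N (ground N - X) = rank N} = {{}}" by auto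
  then have "inv_Z_term inv_KL N {} = inv_KL N"
    using restrict_ground[OF assms] by (simp add: inv_Z_term_def spanning_sum_def)
  moreover have "finite (Pow (ground N))" using finite_ground[OF assms] by simp
  ultimately show ?thesis
    unfolding inv_Z_def inv_Z_sum_eq_sum_Pow[OF assms] by (simp add: sum.remove[of _ "{}"])
qed

text \<open>Here d is the rank lost by deleting T. Extracting (-1)^d from the spanning sum lets it
  cancel the sign in front of the Moebius value.\<close>

lemma inv_Z_term_eq:
  assumes "rank M = rk M (ground M - T) + d" "spanning_sum M T = (-1) ^ d * c"
  shows "inv_Z_term Q M T = of_int c * var ^ d * Q (restrict M (ground M - T))"
proof -
  have "(-1) ^ d * ((-1) ^ d * c) = c" by (simp flip: power_mult_distrib mult.assoc)
  then show ?thesis using assms by (simp add: inv_Z_term_def monom_eq_var)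
qed

section \<open>Free matroids\<close>

lemma matroid_free: "finite (ground M) \<Longrightarrow> indep M = Pow (ground M) \<Longrightarrow> matroid M"
  unfolding matroid_def
proof (intro conjI ballI impI allI)
  fix X Y assume M: "finite (ground M)" "indep M = Pow (ground M)"
    and XY: "X \<in> indep M" "Y \<in> indep M" "card X < card Y"
  have "\<not> Y \<subseteq> X" using M XY card_mono[of X Y] by (auto dest: finite_subset)
  then show "\<exists>y\<in>Y - X. insert y X \<in> indep M" using XY M by auto
qed auto

text \<open>With Q = 1 on all smaller free matroids, Y - Q is (1 + x)^n - 1 on n elements, and the
  constant 1 completes it to the palindromic power (1 + x)^n.\<close>

lemma inv_KL_free:
  assumes "finite (ground M)" "indep M = Pow (ground M)"
  shows "inv_KL M = 1"
  using assms
proof (induction "card (ground M)" arbitrary: M rule: less_induct)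
  case less
  let ?E = "ground M"
  have M: "matroid M" and ll: "loopless M"
    using matroid_free[OF less(2,3)] less(3) by (auto simp: loopless_def)
  have rk: "rk M A = card A" if "A \<subseteq> ?E" for A
    using rk_indep[OF M, of A] that less(3) by simp
  show ?case
  proof (cases "?E = {}")
    case True
    then show ?thesis using rk[of ?E] by (intro inv_KL_rank_0 M ll) simp
  next
    case False
    have tm: "inv_Z_term inv_KL M T = var ^ card T" if T: "T \<in> Pow ?E - {{}}" for T
    proof -
      have fT: "finite T" using T less(2) finite_subset by auto
      have "card (?E - T) + card T = card ?E"
        using T less(2) fT card_mono[of ?E T] by (simp add: card_Diff_subset)
      then have 1: "rank M = rk M (?E - T) + card T" using rk[of ?E] rk[of "?E - T"] by simp
      have "{X. X \<subseteq> T \<and> rk M (?E - X) = rank M} = {{}}"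
      proof safe
        fix X y assume X: "X \<subseteq> T" "rk M (?E - X) = rank M" "y \<in> X"
        then have "card (?E - X) = card ?E" using rk[of "?E - X"] rk[of ?E] by simp
        then have "?E - X = ?E" using less(2) by (intro card_subset_eq) auto
        then show "y \<in> {}" using X T by auto
      qed auto
      then have 2: "spanning_sum M T = (-1) ^ card T * 1" by (simp add: spanning_sum_def)
      have "?E - T \<subset> ?E" using T by auto
      then have "card (?E - T) < card ?E" using less(2) by (intro psubset_card_mono)
      then have "inv_KL (restrict M (?E - T)) = 1"
        using less(2,3) by (intro less(1)) (auto simp: restrict_def)
      then show ?thesis using inv_Z_term_eq[OF 1 2, of inv_KL] by simp
    qed
    have "(\<Sum>T\<in>Pow ?E - {{}}. inv_Z_term inv_KL M T) = (\<Sum>T\<in>Pow ?E - {{}}. var ^ card T)"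
      using tm by (rule sum.cong[OF refl])
    also have "\<dots> = (1 + var) ^ card ?E - 1"
      using sum_Pow_power_card[OF less(2), of var] less(2) by (simp add: sum_diff1)
    finally have Z: "inv_Z M = inv_KL M + ((1 + var) ^ card ?E - 1)" using inv_Z_split[OF M] by simp
    have pos: "card ?E > 0" using False less(2) by (simp add: card_gt_0_iff)
    have "low (card ?E) 1" using pos by (auto simp: low_def)
    moreover have "rank M = card ?E" using rk[of ?E] by simp
    ultimately show ?thesis
      using palindromic_power_var[of "card ?E"] pos by (intro inv_KL_eqI[OF M ll _ Z]) auto
  qed
qed

section \<open>A single circuit together with coloops\<close>

definition circuit_matroid :: "'a set \<Rightarrow> 'a set \<Rightarrow> 'a indep_system" where
  "circuit_matroid E D = \<lparr>ground = E, indep = {X. X \<subseteq> E \<and> \<not> D \<subseteq> X}\<rparr>"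

lemma ground_circuit_matroid [simp]: "ground (circuit_matroid E D) = E"
  by (simp add: circuit_matroid_def)

context
  fixes E D :: "'a set"
  assumes finE: "finite E" and DE: "D \<subseteq> E" and D: "D \<noteq> {}"
begin

lemma matroid_circuit_matroid: "matroid (circuit_matroid E D)"
  unfolding matroid_def
proof (intro conjI ballI impI allI)
  fix X Y assume X: "X \<in> indep (circuit_matroid E D)" and Y: "Y \<in> indep (circuit_matroid E D)"
    and less: "card X < card Y"
  have fin: "finite X" "finite Y" using X Y finE by (auto simp: circuit_matroid_def finite_subset)
  show "\<exists>y\<in>Y - X. insert y X \<in> indep (circuit_matroid E D)"
  proof (rule ccontr)
    assume "\<not> ?thesis"
    then have *: "D \<subseteq> insert y X" if "y \<in> Y - X" for y
      using that X Y by (auto simp: circuit_matroid_def)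
    have "\<not> Y \<subseteq> X" using less card_mono[OF fin(1), of Y] by linarith
    then obtain y where y: "y \<in> Y - X" by blast
    have "\<not> D \<subseteq> X" using X by (simp add: circuit_matroid_def)
    \<comment> \<open>Every candidate y completes X to a superset of D, so it is the unique element
      of D missing from X.\<close>
    then have "Y - X = {y}" using * y by blast
    then have "Y \<subseteq> insert y X" by blast
    then have "Y = insert y X" using less y fin by (intro card_seteq) auto
    then show False using *[OF y] Y by (simp add: circuit_matroid_def)
  qed
qed (use finE D in \<open>auto simp: circuit_matroid_def\<close>)

lemma rk_circuit_matroid:
  assumes "A \<subseteq> E"
  shows "rk (circuit_matroid E D) A = (if D \<subseteq> A then card A - 1 else card A)"
proof (cases "D \<subseteq> A")
  case True
  have fA: "finite A" using assms finE finite_subset by blast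
  obtain d where d: "d \<in> D" using D by blast
  have "rk (circuit_matroid E D) A = card A - 1"
  proof (rule rk_eqI[OF matroid_circuit_matroid])
    show "A - {d} \<in> indep (circuit_matroid E D)" using d assms by (auto simp: circuit_matroid_def)
    show "card (A - {d}) = card A - 1" using d True by (intro card_Diff_singleton) auto
    fix X assume X: "X \<in> indep (circuit_matroid E D)" "X \<subseteq> A"
    then have "X \<subset> A" using True by (auto simp: circuit_matroid_def)
    then have "card X < card A" using fA by (intro psubset_card_mono)
    then show "card X \<le> card A - 1" by simp
  qed auto
  then show ?thesis using True by simp
next
  case False
  then have "A \<in> indep (circuit_matroid E D)" using assms by (simp add: circuit_matroid_def)
  then show ?thesis using rk_indep[OF matroid_circuit_matroid] False by simp
qed

end

lemma loopless_circuit_matroid: "2 \<le> card D \<Longrightarrow> loopless (circuit_matroid E D)"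
  by (auto simp: loopless_def circuit_matroid_def subset_singleton_iff)

lemma restrict_circuit_matroid: "A \<subseteq> E \<Longrightarrow> restrict (circuit_matroid E D) A = circuit_matroid A D"
  by (auto simp: restrict_def circuit_matroid_def)

text \<open>If T misses D it consists of coloops: only the empty set can be removed without loss of
  rank, and the restriction still has the circuit D. If T meets D the restriction is free, the rank
  drops by one less than \<open>card T\<close>, and the removable sets are the empty set and the
  singletons of \<open>T \<inter> D\<close>, which gives the factor
  \<open>card (T \<inter> D) - 1\<close> up to sign.\<close>

lemma inv_Z_term_circuit_matroid:
  assumes "finite E" "D \<subseteq> E" "D \<noteq> {}" "T \<subseteq> E"
  shows "inv_Z_term inv_KL (circuit_matroid E D) T =
    (if T \<inter> D = {} then var ^ card T * inv_KL (circuit_matroid (E - T) D)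
     else (of_nat (card (T \<inter> D)) - 1) * var ^ (card T - 1))"
proof -
  let ?M = "circuit_matroid E D"
  note rk = rk_circuit_matroid[OF assms(1-3)]
  have fT: "finite T" using assms finite_subset by auto
  have pos: "0 < card E" using assms by (auto simp: card_gt_0_iff)
  have card_E: "card E = card (E - X) + card X" if "X \<subseteq> T" for X
    using that assms card_mono[of E X] finite_subset[of X E] by (auto simp: card_Diff_subset)
  have rkE: "rank ?M = card E - 1" using rk[of E] assms by simp
  show ?thesis
  proof (cases "T \<inter> D = {}")
    case True
    have rkX: "rk ?M (E - X) = card (E - X) - 1" and posX: "0 < card (E - X)" if "X \<subseteq> T" for X
    proof -
      have sub: "D \<subseteq> E - X" using that True assms by blast
      then show "rk ?M (E - X) = card (E - X) - 1" using rk[of "E - X"] by simp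
      show "0 < card (E - X)" using sub assms by (auto simp: card_gt_0_iff)
    qed
    have 1: "rank ?M = rk ?M (ground ?M - T) + card T"
      using rkX[of T] posX[of T] card_E[of T] rkE by simp
    have "X = {}" if X: "X \<subseteq> T" "rk ?M (E - X) = rank ?M" for X
    proof -
      have "card X = 0" using rkX[OF X(1)] posX[OF X(1)] card_E[OF X(1)] rkE X(2) by linarith
      then show ?thesis using finite_subset[OF X(1) fT] by simp
    qed
    then have "{X. X \<subseteq> T \<and> rk ?M (ground ?M - X) = rank ?M} = {{}}" by auto
    then have 2: "spanning_sum ?M T = (-1) ^ card T * 1" by (simp add: spanning_sum_def)
    show ?thesis using inv_Z_term_eq[OF 1 2, of inv_KL] True
      by (simp add: restrict_circuit_matroid)
  next
    case False
    have rkX: "rk ?M (E - X) = card (E - X)" if "X \<inter> D \<noteq> {}" for X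
      using rk[of "E - X"] that by auto
    have T0: "0 < card T" using False fT by (auto simp: card_gt_0_iff)
    have 1: "rank ?M = rk ?M (ground ?M - T) + (card T - 1)"
      using rkX[OF False] card_E[of T] rkE T0 by simp
    have "{X. X \<subseteq> T \<and> rk ?M (ground ?M - X) = rank ?M} = insert {} ((\<lambda>e. {e}) ` (T \<inter> D))"
    proof (intro equalityI subsetI)
      fix X assume X: "X \<in> {X. X \<subseteq> T \<and> rk ?M (ground ?M - X) = rank ?M}"
      show "X \<in> insert {} ((\<lambda>e. {e}) ` (T \<inter> D))"
      proof (cases "X \<inter> D = {}")
        case True
        then have "D \<subseteq> E - X" using assms by blast
        then have "0 < card (E - X)" "rk ?M (E - X) = card (E - X) - 1"
          using assms rk[of "E - X"] by (auto simp: card_gt_0_iff)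
        then have "card X = 0" using card_E[of X] X rkE by auto
        then show ?thesis using X fT finite_subset[of X T] by auto
      next
        case False
        then have "card X = 1" using rkX[of X] card_E[of X] X rkE pos by auto
        then show ?thesis using False X by (auto simp: card_1_singleton_iff)
      qed
    next
      fix X assume "X \<in> insert {} ((\<lambda>e. {e}) ` (T \<inter> D))"
      then consider "X = {}" | e where "X = {e}" "e \<in> T" "e \<in> D" by blast
      then show "X \<in> {X. X \<subseteq> T \<and> rk ?M (ground ?M - X) = rank ?M}"
      proof cases
        case 2
        then have "rk ?M (E - X) = card (E - X)" by (intro rkX) auto
        then show ?thesis using 2 card_E[of X] rkE by auto
      qed auto
    qed
    moreover have "(\<Sum>X\<in>(\<lambda>e. {e}) ` (T \<inter> D). (-1) ^ (card T + card X)) =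
        - (of_nat (card (T \<inter> D)) * (-1) ^ card T :: int)"
      by (subst sum.reindex) (auto simp: inj_on_def)
    ultimately have "spanning_sum ?M T = (-1) ^ card T * (1 - of_nat (card (T \<inter> D)))"
      using fT unfolding spanning_sum_def by (subst (asm) eq_commute, simp add: image_iff algebra_simps)
    also have "\<dots> = (-1) ^ (card T - 1) * (of_nat (card (T \<inter> D)) - 1)"
      using T0 by (cases "card T") (simp_all add: algebra_simps)
    finally have 2: "spanning_sum ?M T = (-1) ^ (card T - 1) * (of_nat (card (T \<inter> D)) - 1)" .
    have "inv_KL (restrict ?M (E - T)) = 1"
      using False assms by (intro inv_KL_free) (auto simp: restrict_def circuit_matroid_def)
    then show ?thesis using inv_Z_term_eq[OF 1 2, of inv_KL] False by simp
  qed
qed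

text \<open>A T meeting D splits into the independent choices \<open>T \<inter> D\<close> and
  \<open>T - D\<close>, so its sum factors into \<open>var * H\<close> and a power of
  \<open>1 + var\<close>. The values on smaller matroids are an assumption so that the computation
  serves inside the induction for Q and again afterwards for Y.\<close>

lemma inv_Z_circuit_matroid_aux:
  assumes "finite E" "D \<subseteq> E" "D \<noteq> {}"
    and IH: "\<And>T. T \<subseteq> E - D \<Longrightarrow> T \<noteq> {} \<Longrightarrow> inv_KL (circuit_matroid (E - T) D) = qcirc (card D)"
  shows "inv_Z (circuit_matroid E D) = inv_KL (circuit_matroid E D) +
    ((1 + var) ^ card (E - D) * (qcirc (card D) + var * H (card D)) - qcirc (card D))"
proof -
  let ?M = "circuit_matroid E D"
  let ?t = "inv_Z_term inv_KL ?M"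
  have fD: "finite D" using assms finite_subset by auto
  have "(\<Sum>T\<in>Pow E - {{}}. ?t T) = (\<Sum>T\<in>Pow (E - D) - {{}}. ?t T) + (\<Sum>T\<in>{T \<in> Pow E. T \<inter> D \<noteq> {}}. ?t T)"
    using assms by (subst sum.union_disjoint[symmetric]) (auto intro!: sum.cong)
  also have "(\<Sum>T\<in>Pow (E - D) - {{}}. ?t T) = (\<Sum>T\<in>Pow (E - D) - {{}}. var ^ card T * qcirc (card D))"
  proof (rule sum.cong)
    fix T assume T: "T \<in> Pow (E - D) - {{}}"
    then have "T \<inter> D = {}" "T \<subseteq> E" by auto
    then show "?t T = var ^ card T * qcirc (card D)"
      using T inv_Z_term_circuit_matroid[OF assms(1-3), of T] IH[of T] by simp
  qed simp
  also have "\<dots> = ((1 + var) ^ card (E - D) - 1) * qcirc (card D)"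
    using sum_Pow_power_card[of "E - D" var] assms(1) by (simp add: sum_diff1 sum_distrib_right[symmetric])
  also have "(\<Sum>T\<in>{T \<in> Pow E. T \<inter> D \<noteq> {}}. ?t T) =
      (\<Sum>(A, B)\<in>(Pow D - {{}}) \<times> Pow (E - D). var * hterm (card A) * var ^ card B)"
  proof (rule sum.reindex_bij_witness[of _ "\<lambda>(A, B). A \<union> B" "\<lambda>T. (T \<inter> D, T - D)"])
    fix T assume T: "T \<in> {T \<in> Pow E. T \<inter> D \<noteq> {}}"
    have "finite (T \<inter> D)" using fD by simp
    then have pos: "0 < card (T \<inter> D)" using T by (simp add: card_gt_0_iff)
    have "finite T" using T assms(1) finite_subset by auto
    then have "card T = card (T \<inter> D) + card (T - D)" by (rule card_Int_Diff)
    then have exp: "card T - 1 = (card (T \<inter> D) - 1) + card (T - D)" using pos by simp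
    have "?t T = (of_nat (card (T \<inter> D)) - 1) * var ^ (card T - 1)"
      using T inv_Z_term_circuit_matroid[OF assms(1-3), of T] by simp
    also have "\<dots> = var * hterm (card (T \<inter> D)) * var ^ card (T - D)"
      unfolding var_hterm[OF pos] exp power_add by (simp only: mult.assoc)
    finally show "(case (T \<inter> D, T - D) of (A, B) \<Rightarrow> var * hterm (card A) * var ^ card B) = ?t T" by simp
  qed (use assms in auto)
  also have "\<dots> = (\<Sum>A\<in>Pow D - {{}}. \<Sum>B\<in>Pow (E - D). var * hterm (card A) * var ^ card B)"
    by (rule sum.cartesian_product[symmetric])
  also have "\<dots> = (\<Sum>A\<in>Pow D - {{}}. var * hterm (card A) * (1 + var) ^ card (E - D))"
    using sum_Pow_power_card[of "E - D" var] assms(1) by (simp add: sum_distrib_left[symmetric])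
  \<comment> \<open>The empty set may be added because \<open>hterm 0 = 0\<close>.\<close>
  also have "\<dots> = (\<Sum>A\<in>Pow D. var * hterm (card A) * (1 + var) ^ card (E - D))"
    using fD by (intro sum.mono_neutral_left) (auto simp: hterm_def)
  also have "\<dots> = var * H (card D) * (1 + var) ^ card (E - D)"
    by (simp only: sum_hterm[OF fD, symmetric] sum_distrib_left sum_distrib_right)
  finally show ?thesis using inv_Z_split[OF matroid_circuit_matroid[OF assms(1-3)]]
    by (simp add: algebra_simps)
qed

text \<open>Coloops multiply Y by powers of 1 + x and leave Q unchanged: a palindromic polynomial
  times (1 + x)^c is palindromic, and \<open>qcirc\<close> is still low in the larger rank. For
  \<open>card D = 1\<close> there is a loop and both sides are 0.\<close>

lemma inv_KL_circuit_matroid: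
  assumes "finite E" "D \<subseteq> E" "D \<noteq> {}"
  shows "inv_KL (circuit_matroid E D) = qcirc (card D)"
  using assms
proof (induction "card E" arbitrary: E rule: less_induct)
  case less
  have fD: "finite D" using less finite_subset by auto
  show ?case
  proof (cases "card D = 1")
    case True
    then obtain d where "D = {d}" by (auto simp: card_1_singleton_iff)
    then have "\<not> loopless (circuit_matroid E D)" using less by (auto simp: loopless_def circuit_matroid_def)
    then show ?thesis using True by (simp add: inv_KL_not_loopless qcirc_1)
  next
    case False
    then have D2: "2 \<le> card D" using less(4) fD by (metis One_nat_def Suc_1 Suc_leI card_gt_0_iff le_neq_implies_less)
    let ?M = "circuit_matroid E D"
    note M = matroid_circuit_matroid[OF less(2-4)]
    have DE: "card D \<le> card E" using less by (intro card_mono)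
    have rank: "rank ?M = card (E - D) + (card D - 1)"
      using rk_circuit_matroid[OF less(2-4), of E] less(3) fD D2 DE by (simp add: card_Diff_subset)
    have "inv_KL (circuit_matroid (E - T) D) = qcirc (card D)" if T: "T \<subseteq> E - D" "T \<noteq> {}" for T
    proof (rule less(1))
      show "card (E - T) < card E" using T less(2) by (intro psubset_card_mono) auto
    qed (use T less in auto)
    note Z = inv_Z_circuit_matroid_aux[OF less(2-4) this]
    have "low (card (E - D) + (card D - 1)) (qcirc (card D))"
      using low_trunc[of "card D - 1" "var * H (card D)"] by (auto simp: low_def qcirc_def)
    then show ?thesis
      using palindromic_mult[OF palindromic_power_var[of "card (E - D)"] palindromic_qcirc[of "card D"]] D2 rank
      by (intro inv_KL_eqI[OF M loopless_circuit_matroid[OF D2] _ Z]) simp_all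
  qed
qed

lemma inv_Z_circuit_matroid:
  assumes "finite E" "E \<noteq> {}"
  shows "inv_Z (circuit_matroid E E) = qcirc (card E) + var * H (card E)"
  using inv_Z_circuit_matroid_aux[of E E] inv_KL_circuit_matroid[of E E] assms by simp

section \<open>Duals of partition matroids of rank 2\<close>

text \<open>A set is independent in the dual when its complement spans the rank-2 matroid, and a set
  spans that matroid unless some parallel class contains it.\<close>

definition partition_dual :: "'a set \<Rightarrow> 'a set set \<Rightarrow> 'a indep_system" where
  "partition_dual E P = \<lparr>ground = E, indep = {X. X \<subseteq> E \<and> (\<forall>S\<in>P. \<not> E - X \<subseteq> S)}\<rparr>"

lemma ground_partition_dual [simp]: "ground (partition_dual E P) = E"
  by (simp add: partition_dual_def)

text \<open>The correction due to a block S of size s. The first summand collects the terms of the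
  nonempty T inside S. In \<open>kappa\<close> every T is treated as lying in no block and every
  pair as lying in none, so \<open>H s\<close> undoes the former on S and the binomial removes the
  pairs inside S.\<close>

definition rho :: "nat \<Rightarrow> nat \<Rightarrow> int poly" where
  "rho n s = var * H s * qcirc (n - s) + H s - of_nat (s choose 2) * (1 + var) ^ (n - 2)"

text \<open>The value of Y - Q when all blocks are singletons, since
  \<open>rho n 1 = 0\<close>.\<close>

definition kappa :: "nat \<Rightarrow> int poly" where
  "kappa n = of_nat (n choose 2) * (1 + var) ^ (n - 2) - H n"

lemma rho_1: "rho n (Suc 0) = 0"
  by (simp add: rho_def H_1)

section \<open>Blocks, independent sets and ranks\<close>

context
  fixes E :: "'a set" and P :: "'a set set"
  assumes finE: "finite E" and part: "partition_on E P" and P2: "2 \<le> card P"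
begin

lemma block_subset: "S \<in> P \<Longrightarrow> S \<subseteq> E"
  using partition_onD1[OF part] by blast

lemma block_nonempty: "S \<in> P \<Longrightarrow> S \<noteq> {}"
  using partition_onD3[OF part] by blast

lemma block_exists: "e \<in> E \<Longrightarrow> \<exists>S\<in>P. e \<in> S"
  using partition_onD1[OF part] by blast

lemma block_unique: "S \<in> P \<Longrightarrow> S' \<in> P \<Longrightarrow> e \<in> S \<Longrightarrow> e \<in> S' \<Longrightarrow> S = S'"
  using disjointD[OF partition_onD2[OF part], of S S'] by blast

lemma finite_P: "finite P"
  using finite_elements[OF finE part] .

lemma block_finite: "S \<in> P \<Longrightarrow> finite S"
  using block_subset finE finite_subset by blast

lemma block_neq_ground:
  assumes "S \<in> P"
  shows "S \<noteq> E"
proof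
  assume "S = E"
  have "card (P - {S}) \<noteq> 0" using P2 finite_P assms by simp
  then have "P - {S} \<noteq> {}" by (metis card.empty)
  then obtain S' where S': "S' \<in> P" "S' \<noteq> S" by blast
  obtain e where "e \<in> S'" using block_nonempty[OF S'(1)] by blast
  then show False using block_unique[OF assms S'(1)] block_subset[OF S'(1)] S'(2) \<open>S = E\<close> by blast
qed

lemma P_nonempty: "P \<noteq> {}"
  using P2 by auto

lemma nonblock_pair:
  assumes "T \<subseteq> E" "\<forall>S\<in>P. \<not> T \<subseteq> S"
  obtains e f where "e \<in> T" "f \<in> T" "e \<noteq> f" "\<forall>S\<in>P. \<not> {e, f} \<subseteq> S"
proof -
  obtain e where e: "e \<in> T" using assms(2) P_nonempty by blast
  then obtain S where S: "S \<in> P" "e \<in> S" using block_exists assms(1) by blast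
  then obtain f where f: "f \<in> T" "f \<notin> S" using assms(2) by blast
  have "\<forall>S'\<in>P. \<not> {e, f} \<subseteq> S'" using block_unique[OF S(1) _ S(2)] f(2) by auto
  then show ?thesis using that[of e f] e f S(2) by blast
qed

lemma nonblock_card:
  assumes "T \<subseteq> E" "\<forall>S\<in>P. \<not> T \<subseteq> S"
  shows "2 \<le> card T"
proof -
  obtain e f where ef: "e \<in> T" "f \<in> T" "e \<noteq> f" using nonblock_pair[OF assms] by metis
  have "card {e, f} \<le> card T" using ef finite_subset[OF assms(1) finE] by (intro card_mono) auto
  then show ?thesis using ef(3) by simp
qed

lemma ground_nonblock: "\<forall>S\<in>P. \<not> E \<subseteq> S"
  using block_subset block_neq_ground by blast

lemma indep_partition_dual:
  "X \<in> indep (partition_dual E P) \<longleftrightarrow> X \<subseteq> E \<and> (\<forall>S\<in>P. \<not> E - X \<subseteq> S)"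
  by (simp add: partition_dual_def)

text \<open>For augmentation, suppose every y in \<open>Y - X\<close> fails: adding it to X traps
  the remaining complement in a block S, and y is not in S. The complement of X has at least three
  elements, so for a second candidate z some w remains besides y and z. It forces the blocks of y
  and z to agree, but the block of z contains y. So Y is \<open>insert y X\<close>, whose complement
  lies in S.\<close>

lemma matroid_partition_dual: "matroid (partition_dual E P)"
  unfolding matroid_def
proof (intro conjI ballI impI allI)
  show "{} \<in> indep (partition_dual E P)" using ground_nonblock by (simp add: indep_partition_dual)
next
  fix X Y assume "X \<in> indep (partition_dual E P)" "Y \<subseteq> X"
  moreover from this have "E - X \<subseteq> E - Y" by blast
  ultimately show "Y \<in> indep (partition_dual E P)"
    unfolding indep_partition_dual by (meson subset_trans)
next
  fix X Y assume X: "X \<in> indep (partition_dual E P)" and Y: "Y \<in> indep (partition_dual E P)"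
    and less: "card X < card Y"
  have sub: "X \<subseteq> E" "Y \<subseteq> E" and fin: "finite X" "finite Y"
    using X Y finE by (auto simp: indep_partition_dual finite_subset)
  show "\<exists>y\<in>Y - X. insert y X \<in> indep (partition_dual E P)"
  proof (rule ccontr)
    assume "\<not> ?thesis"
    then have *: "\<exists>S\<in>P. E - insert y X \<subseteq> S" if "y \<in> Y - X" for y
      using that sub by (auto simp: indep_partition_dual)
    have "\<not> Y \<subseteq> X" using less card_mono[OF fin(1), of Y] by linarith
    then obtain y where y: "y \<in> Y - X" by blast
    then obtain S where S: "S \<in> P" "E - insert y X \<subseteq> S" using * by blast
    have yS: "y \<notin> S" using S X by (auto simp: indep_partition_dual)
    have "card (E - Y) < card (E - X)"
      using less sub fin finE card_mono[OF finE sub(2)] by (simp add: card_Diff_subset)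
    moreover have "2 \<le> card (E - Y)" using Y by (intro nonblock_card) (auto simp: indep_partition_dual)
    ultimately have "3 \<le> card (E - X)" by simp
    moreover have "card (E - X) = Suc (card (E - X - {y}))"
      using y sub finE by (intro card.remove) auto
    moreover have "E - X - {y} = E - insert y X" by blast
    ultimately have "2 \<le> card (E - insert y X)" by simp
    have "Y - X \<subseteq> {y}"
    proof
      fix z assume z: "z \<in> Y - X"
      show "z \<in> {y}"
      proof (rule ccontr)
        assume "z \<notin> {y}"
        obtain S' where S': "S' \<in> P" "E - insert z X \<subseteq> S'" using * z by blast
        have "y \<in> S'" using y \<open>z \<notin> {y}\<close> S' sub by auto
        have "card (E - insert y X) \<le> card {z} \<Longrightarrow> False" using \<open>2 \<le> card (E - insert y X)\<close> by simp
        then have "\<not> E - insert y X \<subseteq> {z}" using card_mono[of "{z}" "E - insert y X"] by auto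
        then obtain w where "w \<in> E - insert y X" "w \<noteq> z" by blast
        then have "w \<in> S" "w \<in> S'" using S S' by auto
        then show False using block_unique[OF S(1) S'(1)] yS \<open>y \<in> S'\<close> by blast
      qed
    qed
    then have "Y \<subseteq> insert y X" by blast
    then have "Y = insert y X" using less y fin by (intro card_seteq) auto
    then show False using S Y by (auto simp: indep_partition_dual)
  qed
qed (use finE in \<open>auto simp: indep_partition_dual\<close>)

lemma card_compl: "T \<subseteq> E \<Longrightarrow> card E = card (E - T) + card T"
  using card_mono[OF finE, of T] finite_subset[OF _ finE, of T] by (simp add: card_Diff_subset)

lemma rk_nonblock:
  assumes "T \<subseteq> E" "\<forall>S\<in>P. \<not> T \<subseteq> S"
  shows "rk (partition_dual E P) (E - T) = card (E - T)"
proof -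
  have "E - (E - T) = T" using assms(1) by blast
  then have "E - T \<in> indep (partition_dual E P)" using assms by (simp add: indep_partition_dual)
  then show ?thesis by (rule rk_indep[OF matroid_partition_dual])
qed

lemma rank_partition_dual: "rank (partition_dual E P) + 2 = card E"
proof -
  obtain e f where ef: "e \<in> E" "f \<in> E" "e \<noteq> f" "\<forall>S\<in>P. \<not> {e, f} \<subseteq> S"
    using nonblock_pair[OF subset_refl ground_nonblock] .
  have c: "card E = card (E - {e, f}) + 2" using card_compl[of "{e, f}"] ef by simp
  have "rk (partition_dual E P) E = card (E - {e, f})"
  proof (rule rk_eqI[OF matroid_partition_dual])
    have "E - (E - {e, f}) = {e, f}" using ef by blast
    then show "E - {e, f} \<in> indep (partition_dual E P)" using ef by (simp add: indep_partition_dual)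
    fix X assume X: "X \<in> indep (partition_dual E P)"
    then have "2 \<le> card (E - X)" by (intro nonblock_card) (auto simp: indep_partition_dual)
    then show "card X \<le> card (E - {e, f})"
      using card_compl[of X] c X by (auto simp: indep_partition_dual)
  qed auto
  then show ?thesis using c by simp
qed

text \<open>The complement of T is dependent, and dropping one further element y outside S makes it
  independent: the removed set \<open>insert y T\<close> meets two blocks.\<close>

lemma rk_block:
  assumes "T \<subseteq> S" "S \<in> P" "T \<noteq> {}"
  shows "rk (partition_dual E P) (E - T) + 1 = card (E - T)"
proof -
  have TE: "T \<subseteq> E" using assms block_subset by blast
  obtain y where y: "y \<in> E" "y \<notin> S" using block_neq_ground[OF assms(2)] block_subset[OF assms(2)] by blast
  obtain t where t: "t \<in> T" using assms by blast
  have yT: "y \<in> E - T" using y assms by auto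
  have c: "card (E - T) = card (E - T - {y}) + 1"
    using finE card.remove[OF _ yT] by simp
  have "rk (partition_dual E P) (E - T) = card (E - T - {y})"
  proof (rule rk_eqI[OF matroid_partition_dual])
    have "E - (E - T - {y}) = insert y T" using TE y by blast
    moreover have "\<forall>S'\<in>P. \<not> insert y T \<subseteq> S'"
      using block_unique[OF assms(2), of _ t] t assms(1) y(2) by blast
    ultimately show "E - T - {y} \<in> indep (partition_dual E P)" by (auto simp: indep_partition_dual)
    fix X assume X: "X \<in> indep (partition_dual E P)" "X \<subseteq> E - T"
    have "X \<noteq> E - T"
    proof
      assume "X = E - T"
      then have "E - X = T" using TE by blast
      then show False using X assms by (auto simp: indep_partition_dual)
    qed
    then have "X \<subset> E - T" using X by blast
    then have "card X < card (E - T)" using finE by (intro psubset_card_mono) auto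
    then show "card X \<le> card (E - T - {y})" using c by simp
  qed auto
  then show ?thesis using c by simp
qed

text \<open>The bases contained in T of the rank-2 matroid that is dualized.\<close>

definition pairs :: "'a set \<Rightarrow> 'a set set" where
  "pairs T = {X. X \<subseteq> T \<and> card X = 2 \<and> (\<forall>S\<in>P. \<not> X \<subseteq> S)}"

lemma finite_pairs: "T \<subseteq> E \<Longrightarrow> finite (pairs T)"
  using finE by (auto simp: pairs_def intro: finite_subset[of _ "Pow E"])

text \<open>Removing X keeps the rank exactly when X is independent in the dual, which has rank 2
  and no loops: the empty set, the singletons and the pairs in no block.\<close>

lemma spanning_partition_dual:
  assumes T: "T \<subseteq> E"
  shows "{X. X \<subseteq> T \<and> rk (partition_dual E P) (ground (partition_dual E P) - X) = rank (partition_dual E P)} =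
    insert {} ((\<lambda>e. {e}) ` T) \<union> pairs T" (is "?L = ?R")
proof (intro equalityI subsetI)
  fix X assume X: "X \<in> ?L"
  then have XE: "X \<subseteq> E" using T by auto
  consider "X = {}" | S where "X \<noteq> {}" "S \<in> P" "X \<subseteq> S" | "\<forall>S\<in>P. \<not> X \<subseteq> S" by blast
  then show "X \<in> ?R"
  proof cases
    case 2
    then have "card X = 1"
      using rk_block[OF 2(3,2,1)] rank_partition_dual card_compl[OF XE] X by auto
    then show ?thesis using X by (auto simp: card_1_singleton_iff)
  next
    case 3
    then have "card X = 2"
      using rk_nonblock[OF XE] rank_partition_dual card_compl[OF XE] X by auto
    then show ?thesis using X 3 by (simp add: pairs_def)
  qed auto
next
  fix X assume "X \<in> ?R"
  then consider "X = {}" | e where "X = {e}" "e \<in> T" | "X \<in> pairs T" by blast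
  then show "X \<in> ?L"
  proof cases
    case 2
    then have XE: "X \<subseteq> E" using T by auto
    obtain S where "S \<in> P" "e \<in> S" using block_exists 2 T by blast
    then have "rk (partition_dual E P) (E - X) + 1 = card (E - X)" using 2 by (intro rk_block[of X S]) auto
    then show ?thesis using rank_partition_dual card_compl[OF XE] 2 by auto
  next
    case 3
    then have XE: "X \<subseteq> E" "\<forall>S\<in>P. \<not> X \<subseteq> S" "card X = 2" "X \<subseteq> T" using T by (auto simp: pairs_def)
    then show ?thesis using rank_partition_dual card_compl[OF XE(1)] rk_nonblock[OF XE(1,2)] by auto
  qed auto
qed

lemma spanning_sum_partition_dual:
  assumes T: "T \<subseteq> E"
  shows "spanning_sum (partition_dual E P) T = (-1) ^ card T * (1 - of_nat (card T) + of_nat (card (pairs T)))"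
proof -
  have fT: "finite T" using T finE finite_subset by auto
  let ?f = "\<lambda>X. (-1) ^ (card T + card X) :: int"
  have "sum ?f (insert {} ((\<lambda>e. {e}) ` T) \<union> pairs T) = sum ?f (insert {} ((\<lambda>e. {e}) ` T)) + sum ?f (pairs T)"
    using fT finite_pairs[OF T] by (intro sum.union_disjoint) (auto simp: pairs_def)
  also have "sum ?f (pairs T) = (\<Sum>X\<in>pairs T. (-1) ^ card T)"
    by (intro sum.cong) (auto simp: pairs_def)
  also have "sum ?f (insert {} ((\<lambda>e. {e}) ` T)) = ?f {} + sum ?f ((\<lambda>e. {e}) ` T)"
    using fT by (subst sum.insert) auto
  also have "sum ?f ((\<lambda>e. {e}) ` T) = (\<Sum>e\<in>T. - ((-1) ^ card T))"
    by (subst sum.reindex) (auto simp: inj_on_def)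
  finally show ?thesis
    unfolding spanning_sum_def spanning_partition_dual[OF T] by (simp add: algebra_simps)
qed

section \<open>The terms of the inverse Z-polynomial\<close>

lemma pairs_block: "T \<subseteq> S \<Longrightarrow> S \<in> P \<Longrightarrow> pairs T = {}"
  by (auto simp: pairs_def)

text \<open>After deletion of T the circuit \<open>E - S\<close> survives and the elements of
  \<open>S - T\<close> are coloops, so Q of the restriction depends on S but not on T.\<close>

lemma inv_Z_term_block:
  assumes "T \<subseteq> S" "S \<in> P" "T \<noteq> {}"
  shows "inv_Z_term inv_KL (partition_dual E P) T = var * hterm (card T) * qcirc (card E - card S)"
proof -
  have TE: "T \<subseteq> E" using assms block_subset by blast
  have pos: "0 < card T" using assms TE finite_subset[OF TE finE] by (simp add: card_gt_0_iff)
  have 1: "rank (partition_dual E P) = rk (partition_dual E P) (ground (partition_dual E P) - T) + (card T - 1)"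
    using rk_block[OF assms] rank_partition_dual card_compl[OF TE] pos by simp
  have 2: "spanning_sum (partition_dual E P) T = (-1) ^ (card T - 1) * (of_nat (card T) - 1)"
    using spanning_sum_partition_dual[OF TE] pairs_block[OF assms(1,2)] pos
    by (cases "card T") (simp_all add: algebra_simps)
  obtain t where t: "t \<in> T" using assms by blast
  have "restrict (partition_dual E P) (E - T) = circuit_matroid (E - T) (E - S)"
  proof -
    have "(\<forall>S'\<in>P. \<not> E - X \<subseteq> S') \<longleftrightarrow> \<not> E - S \<subseteq> X" if X: "X \<subseteq> E - T" for X
    proof
      assume "\<forall>S'\<in>P. \<not> E - X \<subseteq> S'"
      then have "\<not> E - X \<subseteq> S" using assms by blast
      then show "\<not> E - S \<subseteq> X" by blast
    next
      assume *: "\<not> E - S \<subseteq> X"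
      have "t \<in> E - X" "t \<in> S" using t X assms TE by auto
      then show "\<forall>S'\<in>P. \<not> E - X \<subseteq> S'" using block_unique[OF assms(2)] * by blast
    qed
    then show ?thesis by (auto simp: restrict_def circuit_matroid_def partition_dual_def)
  qed
  moreover have "inv_KL (circuit_matroid (E - T) (E - S)) = qcirc (card (E - S))"
    using assms finE block_neq_ground[OF assms(2)] block_subset[OF assms(2)]
    by (intro inv_KL_circuit_matroid) auto
  moreover have "card (E - S) = card E - card S" using card_compl[OF block_subset[OF assms(2)]] by simp
  ultimately have "inv_KL (restrict (partition_dual E P) (E - T)) = qcirc (card E - card S)" by simp
  then show ?thesis using inv_Z_term_eq[OF 1 2, of inv_KL] var_hterm[OF pos] by simp
qed

text \<open>The complement of T is independent, hence its restriction is free with Q = 1. Only the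
  spanning sum remains, and \<open>hterm\<close> records its part 1 - \<open>card T\<close>.\<close>

lemma inv_Z_term_nonblock:
  assumes T: "T \<subseteq> E" "\<forall>S\<in>P. \<not> T \<subseteq> S"
  shows "inv_Z_term inv_KL (partition_dual E P) T =
    of_nat (card (pairs T)) * var ^ (card T - 2) - hterm (card T)"
proof -
  have T2: "2 \<le> card T" using nonblock_card[OF T] .
  have 1: "rank (partition_dual E P) = rk (partition_dual E P) (ground (partition_dual E P) - T) + (card T - 2)"
    using rk_nonblock[OF T] rank_partition_dual card_compl[OF T(1)] T2 by simp
  have "(-1) ^ card T = ((-1) ^ (card T - 2) :: int)"
    using T2 by (metis diff_add_inverse2 le_add_diff_inverse2 minus_one_power_iff even_add even_numeral)
  then have 2: "spanning_sum (partition_dual E P) T =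
      (-1) ^ (card T - 2) * (1 - of_nat (card T) + of_nat (card (pairs T)))"
    using spanning_sum_partition_dual[OF T(1)] by simp
  have "indep (restrict (partition_dual E P) (E - T)) = Pow (E - T)"
  proof -
    have "\<forall>S\<in>P. \<not> E - X \<subseteq> S" if "X \<subseteq> E - T" for X
    proof -
      have "T \<subseteq> E - X" using that T(1) by blast
      then show ?thesis using T(2) by (meson subset_trans)
    qed
    then show ?thesis unfolding restrict_def partition_dual_def by auto
  qed
  then have "inv_KL (restrict (partition_dual E P) (E - T)) = 1"
    using finE by (intro inv_KL_free) (auto simp: restrict_def)
  then have "inv_Z_term inv_KL (partition_dual E P) T =
      of_int (1 - of_nat (card T) + of_nat (card (pairs T))) * var ^ (card T - 2)"
    using inv_Z_term_eq[OF 1 2, of inv_KL] by simp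
  also have "\<dots> = of_nat (card (pairs T)) * var ^ (card T - 2) - hterm (card T)"
    using T2 by (simp add: hterm_def of_nat_diff algebra_simps)
  finally show ?thesis .
qed

section \<open>Summation over all subsets\<close>

lemma card_pairs: "card (pairs E) + (\<Sum>S\<in>P. card S choose 2) = card E choose 2"
proof -
  have "{X. X \<subseteq> E \<and> card X = 2} = pairs E \<union> (\<Union>S\<in>P. {X. X \<subseteq> S \<and> card X = 2})"
    using block_subset by (auto simp: pairs_def)
  also have "card \<dots> = card (pairs E) + card (\<Union>S\<in>P. {X. X \<subseteq> S \<and> card X = 2})"
    using finite_P block_finite finite_pairs[of E]
    by (intro card_Un_disjoint) (auto simp: pairs_def intro!: finite_UN_I)
  also have "card (\<Union>S\<in>P. {X. X \<subseteq> S \<and> card X = 2}) = (\<Sum>S\<in>P. card {X. X \<subseteq> S \<and> card X = 2})"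
  proof (rule card_UN_disjoint)
    show "\<forall>S\<in>P. finite {X. X \<subseteq> S \<and> card X = 2}" using block_finite by auto
    show "\<forall>S\<in>P. \<forall>S'\<in>P. S \<noteq> S' \<longrightarrow> {X. X \<subseteq> S \<and> card X = 2} \<inter> {X. X \<subseteq> S' \<and> card X = 2} = {}"
    proof (intro ballI impI equals0I)
      fix S S' X assume *: "S \<in> P" "S' \<in> P" "S \<noteq> S'"
        "X \<in> {X. X \<subseteq> S \<and> card X = 2} \<inter> {X. X \<subseteq> S' \<and> card X = 2}"
      then obtain x where "x \<in> X" by fastforce
      then show False using * block_unique[of S S' x] by auto
    qed
  qed (rule finite_P)
  also have "\<dots> = (\<Sum>S\<in>P. card S choose 2)"
    using n_subsets[OF block_finite] by (intro sum.cong) auto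
  finally show ?thesis using n_subsets[OF finE, of 2] by simp
qed

text \<open>Double counting: each pair collects its supersets T, whose weights add up to a power of
  \<open>1 + var\<close>.\<close>

lemma sum_pairs:
  "(\<Sum>T\<in>Pow E. of_nat (card (pairs T)) * var ^ (card T - 2)) =
    of_nat (card (pairs E)) * (1 + var) ^ (card E - 2)"
proof -
  have "(\<Sum>T\<in>Pow E. of_nat (card (pairs T)) * var ^ (card T - 2)) =
      (\<Sum>T\<in>Pow E. \<Sum>X\<in>{X \<in> pairs E. X \<subseteq> T}. var ^ (card T - 2))"
  proof (rule sum.cong)
    fix T assume "T \<in> Pow E"
    then have "{X \<in> pairs E. X \<subseteq> T} = pairs T" by (auto simp: pairs_def)
    then show "of_nat (card (pairs T)) * var ^ (card T - 2) =
      (\<Sum>X\<in>{X \<in> pairs E. X \<subseteq> T}. var ^ (card T - 2))" by simp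
  qed simp
  also have "\<dots> = (\<Sum>X\<in>pairs E. \<Sum>T\<in>{T \<in> Pow E. X \<subseteq> T}. var ^ (card T - 2))"
    using finE finite_pairs[of E] by (intro sum.swap_restrict) auto
  also have "\<dots> = (\<Sum>X\<in>pairs E. (1 + var) ^ (card E - 2))"
  proof (rule sum.cong)
    fix X assume X: "X \<in> pairs E"
    then have X: "X \<subseteq> E" "card X = 2" by (auto simp: pairs_def)
    have "{T \<in> Pow E. X \<subseteq> T} = {T. X \<subseteq> T \<and> T \<subseteq> E}" by auto
    then show "(\<Sum>T\<in>{T \<in> Pow E. X \<subseteq> T}. var ^ (card T - 2)) = (1 + var) ^ (card E - 2)"
      using sum_supersets_power_card[OF finE X(1), of var] X(2) by simp
  qed simp
  finally show ?thesis by simp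
qed

lemma sum_nonempty_subsets_UN:
  fixes f :: "'a set \<Rightarrow> int poly"
  shows "(\<Sum>T\<in>(\<Union>S\<in>P. Pow S - {{}}). f T) = (\<Sum>S\<in>P. \<Sum>T\<in>Pow S - {{}}. f T)"
proof (rule sum.UNION_disjoint)
  show "\<forall>S\<in>P. finite (Pow S - {{}})" using block_finite by auto
  show "\<forall>S\<in>P. \<forall>S'\<in>P. S \<noteq> S' \<longrightarrow> (Pow S - {{}}) \<inter> (Pow S' - {{}}) = {}"
  proof (intro ballI impI equals0I)
    fix S S' T assume *: "S \<in> P" "S' \<in> P" "S \<noteq> S'" "T \<in> (Pow S - {{}}) \<inter> (Pow S' - {{}})"
    then obtain x where "x \<in> T" by blast
    then show False using * block_unique[of S S' x] by auto
  qed
qed (rule finite_P)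

lemma inv_Z_partition_dual_aux:
  "inv_Z (partition_dual E P) = inv_KL (partition_dual E P) + (kappa (card E) + (\<Sum>S\<in>P. rho (card E) (card S)))"
proof -
  let ?n = "card E"
  let ?t = "inv_Z_term inv_KL (partition_dual E P)"
  define B where "B = (\<Union>S\<in>P. Pow S - {{}})"
  define N where "N = {T \<in> Pow E. \<forall>S\<in>P. \<not> T \<subseteq> S}"
  \<comment> \<open>The value of the terms over N, extended to every T. It is summed over all of
    \<open>Pow E\<close>, where binomial sums apply, and then corrected on B; this produces the
    summand \<open>H s\<close> of \<open>rho\<close>.\<close>
  define w where "w T = of_nat (card (pairs T)) * var ^ (card T - 2) - hterm (card T)" for T
  have BE: "B \<subseteq> Pow E" using block_subset unfolding B_def by blast
  have fin: "finite B" "finite N" using finE BE by (auto simp: N_def finite_subset)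
  have split: "Pow E - {{}} = B \<union> N" "B \<inter> N = {}" "{} \<notin> B \<union> N"
    using BE P_nonempty by (auto simp: B_def N_def)
  have "sum ?t B = (\<Sum>S\<in>P. \<Sum>T\<in>Pow S - {{}}. ?t T)"
    unfolding B_def by (rule sum_nonempty_subsets_UN)
  also have "\<dots> = (\<Sum>S\<in>P. var * H (card S) * qcirc (?n - card S))"
  proof (rule sum.cong)
    fix S assume S: "S \<in> P"
    have "(\<Sum>T\<in>Pow S - {{}}. ?t T) = (\<Sum>T\<in>Pow S - {{}}. var * hterm (card T) * qcirc (?n - card S))"
      using S by (intro sum.cong inv_Z_term_block) auto
    also have "\<dots> = (\<Sum>T\<in>Pow S. var * hterm (card T) * qcirc (?n - card S))"
      using block_finite[OF S] by (intro sum.mono_neutral_left) (auto simp: hterm_def)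
    also have "\<dots> = var * H (card S) * qcirc (?n - card S)"
      by (simp only: sum_hterm[OF block_finite[OF S], symmetric] sum_distrib_left sum_distrib_right)
    finally show "(\<Sum>T\<in>Pow S - {{}}. ?t T) = var * H (card S) * qcirc (?n - card S)" .
  qed simp
  finally have tB: "sum ?t B = (\<Sum>S\<in>P. var * H (card S) * qcirc (?n - card S))" .
  have "sum w B = (\<Sum>S\<in>P. \<Sum>T\<in>Pow S - {{}}. w T)"
    unfolding B_def by (rule sum_nonempty_subsets_UN)
  also have "\<dots> = (\<Sum>S\<in>P. - H (card S))"
  proof (rule sum.cong)
    fix S assume S: "S \<in> P"
    have "(\<Sum>T\<in>Pow S - {{}}. w T) = (\<Sum>T\<in>Pow S - {{}}. - hterm (card T))"
      using S pairs_block by (intro sum.cong) (auto simp: w_def)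
    also have "\<dots> = (\<Sum>T\<in>Pow S. - hterm (card T))"
      using block_finite[OF S] by (intro sum.mono_neutral_left) (auto simp: hterm_def)
    finally show "(\<Sum>T\<in>Pow S - {{}}. w T) = - H (card S)"
      using sum_hterm[OF block_finite[OF S]] by (simp add: sum_negf)
  qed simp
  finally have wB: "sum w B = - (\<Sum>S\<in>P. H (card S))" by (simp add: sum_negf)
  have "sum ?t N = sum w N"
    using inv_Z_term_nonblock by (intro sum.cong) (auto simp: N_def w_def)
  also have "\<dots> = sum w (Pow E - {{}}) - sum w B"
    unfolding split(1) using fin split(2) by (simp add: sum.union_disjoint)
  \<comment> \<open>The empty set has no pairs and \<open>hterm 0 = 0\<close>, so
    \<open>w {} = 0\<close>.\<close>
  also have "sum w (Pow E - {{}}) = sum w (Pow E)"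
    using finE by (intro sum.mono_neutral_left) (auto simp: w_def hterm_def pairs_def)
  also have "\<dots> = of_nat (card (pairs E)) * (1 + var) ^ (?n - 2) - H ?n"
    unfolding w_def sum_subtractf using sum_pairs sum_hterm[OF finE] by simp
  finally have "sum ?t N = of_nat (card (pairs E)) * (1 + var) ^ (?n - 2) - H ?n + (\<Sum>S\<in>P. H (card S))"
    using wB by simp
  moreover have "sum ?t (Pow E - {{}}) = sum ?t B + sum ?t N"
    unfolding split(1) using fin split(2) by (simp add: sum.union_disjoint)
  moreover have "(of_nat (card (pairs E)) :: int poly) = of_nat (?n choose 2) - (\<Sum>S\<in>P. of_nat (card S choose 2))"
    unfolding card_pairs[symmetric] by simp
  ultimately have "sum ?t (Pow E - {{}}) = kappa ?n + (\<Sum>S\<in>P. rho ?n (card S))"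
    using tB by (simp add: kappa_def rho_def sum.distrib sum_subtractf sum_distrib_right left_diff_distrib)
  then show ?thesis using inv_Z_split[OF matroid_partition_dual] by simp
qed

end

text \<open>The direct sum of two circuits, recognized by its polynomials alone: the mixed terms
  \<open>var * H a * qcirc b\<close> come from \<open>rho\<close>, and the square term
  \<open>var ^ 2 * H a * H b\<close> from \<open>H_product\<close>.\<close>

lemma kappa_rho_two_blocks:
  assumes "0 < a" "0 < b" "a + b = n"
  shows "kappa n + (rho n a + rho n b) + qcirc a * qcirc b = (qcirc a + var * H a) * (qcirc b + var * H b)"
proof -
  have ab: "n - a = b" "n - b = a" using assms by auto
  \<comment> \<open>Doubling turns the binomials into products without division; a * b counts the
    pairs with one element in each block.\<close>
  have "2 * (n choose 2) = 2 * ((a choose 2) + (b choose 2) + a * b)"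
  proof -
    obtain c d where cd: "a = Suc c" "b = Suc d" using assms by (auto simp: gr0_conv_Suc)
    have two: "2 * (m choose 2) = m * (m - 1)" for m :: nat
      by (cases m) (simp_all add: choose_two)
    show ?thesis unfolding distrib_left two unfolding assms(3)[symmetric] cd by (simp add: algebra_simps)
  qed
  then have ch: "n choose 2 = (a choose 2) + (b choose 2) + a * b" by simp
  have "kappa n + (rho n a + rho n b) =
      (of_nat (a * b) * (1 + var) ^ (a + b - 2) - H (a + b) + H a + H b) +
      var * H a * qcirc b + var * H b * qcirc a"
    unfolding kappa_def rho_def ab ch assms(3) by (simp add: algebra_simps)
  then show ?thesis unfolding H_product[OF assms(1,2)] by (simp add: algebra_simps power2_eq_square)
qed

text \<open>The ranks a - 1 and b - 1 add up to n - 2, so the product of the low-degree parts is low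
  and completes to a palindromic product. The case of a block of size 1 is included, with both sides
  0.\<close>

lemma trunc_two_blocks:
  assumes "0 < a" "0 < b" "a + b = n"
  shows "trunc (n - 2) (kappa n + (rho n a + rho n b)) = qcirc a * qcirc b"
proof (rule trunc_unique[symmetric])
  have n: "n - 2 = (a - 1) + (b - 1)" using assms by simp
  show "low (n - 2) (qcirc a * qcirc b)" unfolding n qcirc_def by (intro low_mult low_trunc)
  show "palindromic (n - 2) (qcirc a * qcirc b + (kappa n + (rho n a + rho n b)))"
    using palindromic_mult[OF palindromic_qcirc palindromic_qcirc, of a b]
    unfolding n kappa_rho_two_blocks[OF assms, symmetric] by (simp only: add.commute)
qed

lemma
  assumes "finite E" "partition_on E P" "2 \<le> card P"
  shows inv_KL_partition_dual:
      "inv_KL (partition_dual E P) = trunc (card E - 2) (kappa (card E) + (\<Sum>S\<in>P. rho (card E) (card S)))"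
    and inv_Z_partition_dual: "inv_Z (partition_dual E P) =
      trunc (card E - 2) (kappa (card E) + (\<Sum>S\<in>P. rho (card E) (card S))) +
      (kappa (card E) + (\<Sum>S\<in>P. rho (card E) (card S)))"
proof -
  let ?M = "partition_dual E P"
  let ?R = "kappa (card E) + (\<Sum>S\<in>P. rho (card E) (card S))"
  note M = matroid_partition_dual[OF assms]
  note rank = rank_partition_dual[OF assms]
  have "inv_KL ?M = trunc (card E - 2) ?R \<and> inv_Z ?M = inv_KL ?M + ?R"
  proof (cases "loopless ?M")
    case True
    have "rank ?M > 0"
    proof (rule ccontr)
      assume "\<not> rank ?M > 0"
      then have "E = {}" using rank_0_loopless[OF M True] by simp
      then show False using rank by simp
    qed
    moreover have "rank ?M = card E - 2" using rank by simp
    ultimately show ?thesis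
      using inv_KL_eq_trunc[OF M True _ inv_Z_partition_dual_aux[OF assms]] inv_Z_partition_dual_aux[OF assms]
      by simp
  next
    \<comment> \<open>A loop e forces the two blocks \<open>E - {e}\<close> and \<open>{e}\<close>.
      Q and Y are 0 by convention, and the formula gives 0 as well, since the circuit of size 1
      contributes a zero factor in \<open>kappa_rho_two_blocks\<close>.\<close>
    case False
    then obtain e where "e \<in> E" "{e} \<notin> indep ?M" by (auto simp: loopless_def)
    then obtain S where S: "S \<in> P" "E - {e} \<subseteq> S" using indep_partition_dual[OF assms] by auto
    have "S \<subseteq> E" "S \<noteq> E" using block_subset[OF assms S(1)] block_neq_ground[OF assms S(1)] by auto
    then have SE: "S = E - {e}" using S \<open>e \<in> E\<close> by blast
    obtain S' where S': "S' \<in> P" "e \<in> S'" using block_exists[OF assms \<open>e \<in> E\<close>] by blast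
    have "S' \<noteq> S" using S' SE by blast
    then have "S' \<inter> S = {}" using S' S disjointD[OF partition_onD2[OF assms(2)]] by blast
    then have S'e: "S' = {e}" using S' SE block_subset[OF assms S'(1)] by blast
    have "X \<in> {S, {e}}" if X: "X \<in> P" for X
    proof -
      obtain x where "x \<in> X" using block_nonempty[OF assms X] by blast
      then have "x \<in> S \<or> x \<in> S'" using SE S'e block_subset[OF assms X] by blast
      then show ?thesis using block_unique[OF assms X] S S' S'e \<open>x \<in> X\<close> by blast
    qed
    then have P: "P = {S, {e}}" using S S' S'e by blast
    have pos: "0 < card S" "0 < card {e}"
      using block_nonempty[OF assms S(1)] block_finite[OF assms S(1)] by (auto simp: card_gt_0_iff)
    have sum: "card S + card {e} = card E"
      using SE \<open>e \<in> E\<close> assms(1) card.remove[of E e] by simp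
    have R: "?R = kappa (card E) + (rho (card E) (card S) + rho (card E) (card {e}))"
      unfolding P using \<open>S' \<noteq> S\<close> S'e by simp
    have "?R = 0"
      using kappa_rho_two_blocks[OF pos sum] unfolding R by (simp add: qcirc_1 H_1)
    then show ?thesis using inv_KL_not_loopless[OF False] inv_Z_not_loopless[OF M False] by simp
  qed
  then show "inv_KL ?M = trunc (card E - 2) ?R" "inv_Z ?M = trunc (card E - 2) ?R + ?R" by auto
qed

section \<open>Matroids of corank 2\<close>

lemma card_basis:
  assumes "matroid M" "basis M B"
  shows "card B = rank M"
proof -
  have B: "B \<in> indep M" "B \<subseteq> ground M"
    using assms indep_subset_ground[OF assms(1)] by (auto simp: basis_def)
  obtain J where "J \<in> indep M" "B \<subseteq> J" "card J = rank M"
    using indep_extend[OF assms(1) B] by blast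
  then show ?thesis using assms(2) unfolding basis_def by metis
qed

lemma basis_if_card:
  assumes "matroid M" "B \<in> indep M" "card B = rank M"
  shows "basis M B"
  unfolding basis_def
proof (intro conjI ballI impI)
  fix X assume "X \<in> indep M" "B \<subseteq> X"
  then have "card X \<le> card B" using card_le_rk[OF assms(1)] indep_subset_ground[OF assms(1)] assms(3) by metis
  then show "X = B" using card_seteq[OF indep_finite[OF assms(1) \<open>X \<in> indep M\<close>] \<open>B \<subseteq> X\<close>] by simp
qed (fact assms(2))

text \<open>R is the parallel relation of the dual: the complement of {e, f} fails to be a basis.
  Its classes are the blocks. Only transitivity is delicate, and it is the place where the absence
  of coloops enters.\<close>

lemma coloopless_corank_2_partition_dual:
  fixes M :: "'a indep_system"
  assumes M: "matroid M" and n: "card (ground M) = rank M + 2" and nc: "\<forall>e. \<not> coloop M e"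
  shows "\<exists>P. partition_on (ground M) P \<and> 2 \<le> card P \<and> M = partition_dual (ground M) P"
proof -
  let ?E = "ground M"
  have fin: "finite ?E" using finite_ground[OF M] .
  define R where "R = {(e, f) \<in> ?E \<times> ?E. ?E - {e, f} \<notin> indep M}"
  have Rsym: "(e, f) \<in> R \<Longrightarrow> (f, e) \<in> R" for e f unfolding R_def by (auto simp: insert_commute)
  have compl2: "card (?E - X) = 2" if "X \<subseteq> ?E" "card X = rank M" for X
    using that n fin by (simp add: card_Diff_subset finite_subset)
  have Rrefl: "(e, e) \<in> R" if "e \<in> ?E" for e
  proof -
    have "?E - {e} \<notin> indep M"
    proof
      assume "?E - {e} \<in> indep M"
      then have "card (?E - {e}) \<le> rank M" by (rule card_le_rk[OF M]) auto
      then show False using that n by simp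
    qed
    then show ?thesis using that by (simp add: R_def)
  qed
  have Rtrans: "(e, g) \<in> R" if "(e, f) \<in> R" "(f, g) \<in> R" for e f g
  proof (rule ccontr)
    assume neg: "(e, g) \<notin> R"
    have E: "e \<in> ?E" "f \<in> ?E" "g \<in> ?E" using that by (auto simp: R_def)
    have eg: "?E - {e, g} \<in> indep M" using neg E by (auto simp: R_def)
    have ne: "e \<noteq> g" "f \<noteq> e" "f \<noteq> g" using neg that Rrefl[OF E(1)] by auto
    \<comment> \<open>Since B avoids f, augmenting \<open>?E - {e, f, g}\<close> from B can only
      bring in e or g, which makes the complement of {f, g} or of {e, f} independent.\<close>
    obtain B where B: "basis M B" "f \<notin> B" using nc E(2) unfolding coloop_def by blast
    have BI: "B \<in> indep M" "B \<subseteq> ?E" using B indep_subset_ground[OF M] by (auto simp: basis_def)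
    have efg: "?E - {e, f, g} \<in> indep M" by (rule indep_subset[OF M eg]) auto
    have "card {e, f, g} = 3" using ne by auto
    then have "card (?E - {e, f, g}) = card ?E - 3" using E card_Diff_subset[of "{e, f, g}" ?E] by auto
    moreover have "3 \<le> card ?E" using card_mono[OF fin, of "{e, f, g}"] E \<open>card {e, f, g} = 3\<close> by auto
    ultimately have "card (?E - {e, f, g}) < card B" using card_basis[OF M B(1)] n by simp
    then obtain y where y: "y \<in> B - (?E - {e, f, g})" "insert y (?E - {e, f, g}) \<in> indep M"
      using indep_augment[OF M efg BI(1)] by blast
    then have "y = e \<or> y = g" using B(2) BI(2) by blast
    then show False
    proof
      assume "y = e"
      then have "insert y (?E - {e, f, g}) = ?E - {f, g}" using E ne by auto
      then show False using y(2) that(2) by (simp add: R_def)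
    next
      assume "y = g"
      then have "insert y (?E - {e, f, g}) = ?E - {e, f}" using E ne by auto
      then show False using y(2) that(1) by (simp add: R_def)
    qed
  qed
  have equiv: "equiv ?E R"
  proof (rule equivI)
    show "R \<subseteq> ?E \<times> ?E" by (auto simp: R_def)
    show "refl_on ?E R" using Rrefl by (rule refl_onI)
    show "sym R" using Rsym by (rule symI)
    show "trans R" using Rtrans by (rule transI)
  qed
  let ?P = "?E // R"
  have part: "partition_on ?E ?P" using partition_on_quotient[OF equiv] .
  have indep: "X \<in> indep M \<longleftrightarrow> X \<subseteq> ?E \<and> (\<forall>S\<in>?P. \<not> ?E - X \<subseteq> S)" for X
  proof (intro iffI conjI ballI notI)
    assume X: "X \<in> indep M"
    then show XE: "X \<subseteq> ?E" by (rule indep_subset_ground[OF M])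
    fix S assume S: "S \<in> ?P" "?E - X \<subseteq> S"
    obtain J where J: "J \<in> indep M" "X \<subseteq> J" "J \<subseteq> ?E" "card J = rank M"
      using indep_extend[OF M X XE] by blast
    then obtain e f where ef: "?E - J = {e, f}" using compl2[OF J(3,4)] by (auto simp: card_2_iff)
    then have "e \<in> S" "f \<in> S" using S J by auto
    then have "(e, f) \<in> R" using quotient_eq_iff[OF equiv S(1) S(1)] by blast
    moreover have "?E - {e, f} = J" using ef J(3) by blast
    ultimately show False using J(1) by (simp add: R_def)
  next
    assume X: "X \<subseteq> ?E \<and> (\<forall>S\<in>?P. \<not> ?E - X \<subseteq> S)"
    have "\<exists>e f. e \<in> ?E - X \<and> f \<in> ?E - X \<and> (e, f) \<notin> R"
    proof (rule ccontr)
      assume *: "\<not> ?thesis"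
      show False
      proof (cases "?E - X = {}")
        case True
        have "?E \<noteq> {}" using n by auto
        then have "?P \<noteq> {}" by (auto simp: quotient_def)
        then show False using X True by auto
      next
        case False
        then obtain e where e: "e \<in> ?E - X" by blast
        then have "?E - X \<subseteq> R `` {e}" using * by blast
        moreover have "R `` {e} \<in> ?P" using e by (intro quotientI) blast
        ultimately show False using X by blast
      qed
    qed
    then obtain e f where ef: "e \<in> ?E - X" "f \<in> ?E - X" "(e, f) \<notin> R" by blast
    then have "?E - {e, f} \<in> indep M" by (auto simp: R_def)
    moreover have "X \<subseteq> ?E - {e, f}" using ef X by auto
    ultimately show "X \<in> indep M" by (rule indep_subset[OF M])
  qed
  have "2 \<le> card ?P"
  proof -
    obtain J where J: "J \<in> indep M" "J \<subseteq> ?E" "card J = rank M" using rk_attained[OF M] by blast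
    have no: "\<not> ?E \<subseteq> S" if "S \<in> ?P" for S
      using that J(1) unfolding indep by blast
    have "?E \<noteq> {}" using n by auto
    then obtain e where e: "e \<in> ?E" by blast
    have S: "R `` {e} \<in> ?P" using e by (rule quotientI)
    then obtain f where f: "f \<in> ?E" "f \<notin> R `` {e}" using no by blast
    have S': "R `` {f} \<in> ?P" using f(1) by (rule quotientI)
    have "R `` {e} \<noteq> R `` {f}" using f Rrefl[OF f(1)] by blast
    then have "card {R `` {e}, R `` {f}} = 2" by simp
    moreover have "card {R `` {e}, R `` {f}} \<le> card ?P"
      using S S' finite_elements[OF fin part] by (intro card_mono) auto
    ultimately show ?thesis by simp
  qed
  moreover have "M = partition_dual ?E ?P"
  proof -
    have "indep M = indep (partition_dual ?E ?P)" unfolding partition_dual_def using indep by auto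
    moreover have "ground M = ground (partition_dual ?E ?P)" by simp
    ultimately show ?thesis by (cases M) (simp add: partition_dual_def)
  qed
  ultimately show ?thesis using part by blast
qed

text \<open>A set contains a basis of the rank-2 matroid exactly when no rank-1 flat contains it:
  such a flat is too small for a basis, and elements of different rank-1 flats form one.\<close>

lemma arises_from_partition_partition_dual:
  assumes "arises_from_partition M E P"
  shows "partition_on E P \<and> 2 \<le> card P \<and> M = partition_dual E P"
proof -
  obtain N where part: "partition_on E P" and N: "matroid N" "ground N = E" "loopless N" "rank N = 2"
    and P: "{F. flat N F \<and> rk N F = 1} = P" and M: "M = dual N"
    using assms unfolding arises_from_partition_def by blast
  have fin: "finite E" using finite_ground[OF N(1)] N(2) by simp
  have E0: "E \<noteq> {}" using N(2,4) rk_empty[OF N(1)] by auto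
  have rk1: "rk N {e} = 1" if "e \<in> E" for e
    using that N rk_indep[OF N(1), of "{e}"] by (auto simp: loopless_def)
  have PE: "\<Union>P = E" using part by (auto simp: partition_on_def)
  have block: "flat N S" "rk N S = 1" if "S \<in> P" for S using that P by auto
  \<comment> \<open>If {e, f} had rank 1, then e would span f, hence so would the flat S, which does
    not contain f.\<close>
  have pair: "{e, f} \<in> indep N \<and> e \<noteq> f" if "S \<in> P" "e \<in> S" "f \<in> E" "f \<notin> S" for S e f
  proof -
    have eE: "e \<in> E" using that PE by blast
    have "rk N {e, f} \<noteq> 1"
    proof
      assume "rk N {e, f} = 1"
      then have "rk N (insert f {e}) = rk N {e}" using rk1[OF eE] by (simp add: insert_commute)
      moreover have "{e} \<subseteq> S" using that(2) by simp
      ultimately have "rk N (insert f S) = rk N S" by (rule rk_insert_mono[OF N(1)])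
      moreover have "rk N S < rk N (insert f S)"
        using block(1)[OF that(1)] that(3,4) N(2) unfolding flat_def by blast
      ultimately show False by simp
    qed
    moreover have "1 \<le> rk N {e, f}" using rk_mono[OF N(1), of "{e}" "{e, f}"] rk1[OF eE] by auto
    moreover have "rk N {e, f} \<le> card {e, f}" by (rule rk_le_card[OF N(1)]) simp
    moreover have ne: "e \<noteq> f" using that by auto
    ultimately have "rk N {e, f} = card {e, f}" by simp
    then show ?thesis using indep_iff_rk[OF N(1), of "{e, f}"] eE that(3) N(2) ne by auto
  qed
  have nonE: "\<exists>f. f \<in> E \<and> f \<notin> S" if "S \<in> P" for S
  proof (rule ccontr)
    assume "\<not> ?thesis"
    moreover have "S \<subseteq> E" using that PE by blast
    ultimately have "S = E" by blast
    then show False using block(2)[OF that] N by simp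
  qed
  obtain e where e: "e \<in> E" using E0 by blast
  then obtain S where S: "S \<in> P" "e \<in> S" using PE by blast
  have "2 \<le> card P"
  proof -
    obtain f where f: "f \<in> E" "f \<notin> S" using nonE[OF S(1)] by blast
    then obtain S' where S': "S' \<in> P" "f \<in> S'" using PE by blast
    then have "card {S, S'} = 2" using f by (auto simp: card_2_iff)
    moreover have "card {S, S'} \<le> card P"
      using S S' finite_elements[OF fin part] by (intro card_mono) auto
    ultimately show ?thesis by simp
  qed
  moreover have "(\<exists>B. basis N B \<and> X \<inter> B = {}) \<longleftrightarrow> (\<forall>S\<in>P. \<not> E - X \<subseteq> S)" if "X \<subseteq> E" for X
  proof
    assume "\<exists>B. basis N B \<and> X \<inter> B = {}"
    then obtain B where B: "basis N B" "X \<inter> B = {}" by blast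
    then have BI: "B \<in> indep N" "B \<subseteq> E" using indep_subset_ground[OF N(1)] N(2) by (auto simp: basis_def)
    show "\<forall>S\<in>P. \<not> E - X \<subseteq> S"
    proof (intro ballI notI)
      fix S assume S: "S \<in> P" "E - X \<subseteq> S"
      then have "B \<subseteq> S" using B BI by blast
      then have "card B \<le> 1" using card_le_rk[OF N(1) BI(1), of S] block[OF S(1)] by simp
      then show False using card_basis[OF N(1) B(1)] N(4) by simp
    qed
  next
    assume *: "\<forall>S\<in>P. \<not> E - X \<subseteq> S"
    have "E - X \<noteq> {}" using * S by blast
    then obtain g where g: "g \<in> E - X" by blast
    then obtain S' where S': "S' \<in> P" "g \<in> S'" using PE by blast
    then obtain f where f: "f \<in> E - X" "f \<notin> S'" using * by blast
    have gf: "{g, f} \<in> indep N \<and> g \<noteq> f" using pair[OF S'] f by blast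
    then have "basis N {g, f}" using N(4) by (intro basis_if_card[OF N(1)]) auto
    moreover have "X \<inter> {g, f} = {}" using f g by blast
    ultimately show "\<exists>B. basis N B \<and> X \<inter> B = {}" by blast
  qed
  then have "M = partition_dual E P"
    unfolding M dual_def partition_dual_def N(2) by auto
  ultimately show ?thesis using part by blast
qed

section \<open>Uniform matroids of corank 1 and 2\<close>

lemma U_corank_1: "0 < m \<Longrightarrow> U (m - 1) m = circuit_matroid {..<m} {..<m}"
proof -
  assume m: "0 < m"
  have "card X \<le> m - 1 \<longleftrightarrow> \<not> {..<m} \<subseteq> X" if X: "X \<subseteq> {..<m}" for X
  proof
    assume "card X \<le> m - 1"
    then show "\<not> {..<m} \<subseteq> X" using X m by auto
  next
    assume "\<not> {..<m} \<subseteq> X"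
    then have "X \<subset> {..<m}" using X by blast
    then have "card X < card {..<m}" by (intro psubset_card_mono) auto
    then show "card X \<le> m - 1" by simp
  qed
  then show ?thesis unfolding U_def uniform_on_def circuit_matroid_def by auto
qed

lemma U_corank_2:
  assumes n: "2 \<le> n"
  shows "U (n - 2) n = partition_dual {..<n} ((\<lambda>i. {i}) ` {..<n})"
proof -
  have "card X \<le> n - 2 \<longleftrightarrow> (\<forall>S\<in>(\<lambda>i. {i}) ` {..<n}. \<not> {..<n} - X \<subseteq> S)" if X: "X \<subseteq> {..<n}" for X
  proof -
    have c: "card ({..<n} - X) = n - card X" and le: "card X \<le> n"
      using X card_mono[of "{..<n}" X] by (auto simp: card_Diff_subset finite_subset)
    have "(\<forall>S\<in>(\<lambda>i. {i}) ` {..<n}. \<not> {..<n} - X \<subseteq> S) \<longleftrightarrow> 2 \<le> card ({..<n} - X)"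
    proof
      assume *: "\<forall>S\<in>(\<lambda>i. {i}) ` {..<n}. \<not> {..<n} - X \<subseteq> S"
      have 0: "{..<n} - X \<noteq> {}" using *[rule_format, of "{0}"] n by auto
      have "card ({..<n} - X) \<noteq> 1"
      proof
        assume "card ({..<n} - X) = 1"
        then obtain i where i: "{..<n} - X = {i}" by (auto simp: card_1_singleton_iff)
        then have "i \<in> {..<n}" by blast
        then show False using *[rule_format, of "{i}"] i by blast
      qed
      moreover have "card ({..<n} - X) \<noteq> 0" using 0 by simp
      ultimately show "2 \<le> card ({..<n} - X)" by linarith
    next
      assume 2: "2 \<le> card ({..<n} - X)"
      show "\<forall>S\<in>(\<lambda>i. {i}) ` {..<n}. \<not> {..<n} - X \<subseteq> S"
      proof (intro ballI notI)
        fix S assume "S \<in> (\<lambda>i. {i}) ` {..<n}" "{..<n} - X \<subseteq> S"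
        then have "card ({..<n} - X) \<le> 1" using card_mono[of S "{..<n} - X"] by auto
        then show False using 2 by simp
      qed
    qed
    then show ?thesis using c le n by auto
  qed
  then show ?thesis unfolding U_def uniform_on_def partition_dual_def by auto
qed

section \<open>Stressed subsets\<close>

lemma uniform_uniform_on: "k \<le> card A \<Longrightarrow> uniform (uniform_on A k)"
  unfolding uniform_def by (intro exI[of _ k]) (simp add: uniform_on_def)

lemma uniform_on_eqD: "uniform_on E k = M \<Longrightarrow> X \<in> indep M \<longleftrightarrow> X \<subseteq> E \<and> card X \<le> k"
  by (auto simp: uniform_on_def)

context
  fixes E :: "'a set" and P :: "'a set set"
  assumes fin: "finite E" and part: "partition_on E P" and P2: "2 \<le> card P"
begin

text \<open>A is dependent, so \<open>E - A\<close> lies in a block S. By uniformity of the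
  restriction, deleting any y from A leaves an independent set; for y in S this is impossible,
  because the complement would still lie in S.\<close>

lemma stressed_circuit_compl_block:
  assumes A: "stressed (partition_dual E P) A" "card A = rk (partition_dual E P) A + 1"
  shows "E - A \<in> P"
proof -
  let ?M = "partition_dual E P"
  note M = matroid_partition_dual[OF fin part P2]
  have AE: "A \<subseteq> E" using A(1) by (simp add: stressed_def)
  obtain k where k: "restrict ?M A = uniform_on A k"
    using A(1) unfolding stressed_def uniform_def by (auto simp: restrict_def)
  have ind: "X \<in> indep ?M \<longleftrightarrow> card X \<le> k" if "X \<subseteq> A" for X
    using uniform_on_eqD[OF k[symmetric], of X] that by (auto simp: restrict_def)
  have "A \<notin> indep ?M" using A(2) rk_indep[OF M, of A] by auto
  then obtain S where S: "S \<in> P" "E - A \<subseteq> S" using indep_partition_dual[OF fin part P2, of A] AE by auto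
  have "rk ?M A \<le> k"
  proof -
    obtain I where "I \<in> indep ?M" "I \<subseteq> A" "card I = rk ?M A" using rk_attained[OF M] by blast
    then show ?thesis using ind by auto
  qed
  have "S \<subseteq> E - A"
  proof (rule ccontr)
    assume "\<not> S \<subseteq> E - A"
    then obtain y where y: "y \<in> S" "y \<in> A" using block_subset[OF fin part P2 S(1)] by blast
    have "card (A - {y}) = rk ?M A" using y A(2) by simp
    then have "A - {y} \<in> indep ?M" using ind[of "A - {y}"] \<open>rk ?M A \<le> k\<close> by auto
    moreover have "E - (A - {y}) \<subseteq> S" using y S by blast
    ultimately show False using indep_partition_dual[OF fin part P2] S(1) by blast
  qed
  then show ?thesis using S by (simp add: subset_antisym)
qed

text \<open>The complement of a block is a circuit, and contracting it leaves a circuit on S: by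
  \<open>rk_block\<close> a proper subset of S raises the rank by its full size, while all of S
  reaches only the total rank n - 2, one short.\<close>

lemma compl_block_stressed:
  assumes S: "S \<in> P"
  shows "stressed (partition_dual E P) (E - S)" "card (E - S) = rk (partition_dual E P) (E - S) + 1"
proof -
  let ?M = "partition_dual E P" and ?A = "E - S"
  note M = matroid_partition_dual[OF fin part P2]
  have SE: "S \<subseteq> E" "S \<noteq> E" "S \<noteq> {}"
    using block_subset[OF fin part P2 S] block_neq_ground[OF fin part P2 S] block_nonempty[OF fin part P2 S] by auto
  have finS: "finite S" using SE fin finite_subset by blast
  show rkA: "card ?A = rk ?M ?A + 1" using rk_block[OF fin part P2 subset_refl S SE(3)] by simp
  have indep: "X \<in> indep ?M \<longleftrightarrow> \<not> ?A \<subseteq> X" if X: "X \<subseteq> E" "\<not> S \<subseteq> X" for X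
  proof -
    obtain t where t: "t \<in> S" "t \<notin> X" using X by blast
    have "S' = S" if "S' \<in> P" "E - X \<subseteq> S'" for S'
      using block_unique[OF fin part P2 S that(1) t(1)] that(2) t SE(1) by blast
    then have "(\<forall>S'\<in>P. \<not> E - X \<subseteq> S') \<longleftrightarrow> \<not> E - X \<subseteq> S" using S by metis
    moreover have "E - X \<subseteq> S \<longleftrightarrow> ?A \<subseteq> X" by blast
    ultimately show ?thesis using indep_partition_dual[OF fin part P2, of X] X by simp
  qed
  have "restrict ?M ?A = uniform_on ?A (card ?A - 1)"
  proof -
    have "X \<in> indep ?M \<longleftrightarrow> card X \<le> card ?A - 1" if X: "X \<subseteq> ?A" for X
    proof -
      have fA: "finite ?A" using fin by simp
      have "\<not> ?A \<subseteq> X \<longleftrightarrow> card X \<le> card ?A - 1"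
      proof
        assume "\<not> ?A \<subseteq> X"
        then have "X \<subset> ?A" using X by blast
        then have "card X < card ?A" by (rule psubset_card_mono[OF fA])
        then show "card X \<le> card ?A - 1" by simp
      next
        assume *: "card X \<le> card ?A - 1"
        show "\<not> ?A \<subseteq> X"
        proof
          assume "?A \<subseteq> X"
          then have "X = ?A" using X by blast
          then show False using * rkA by simp
        qed
      qed
      moreover have "X \<subseteq> E" "\<not> S \<subseteq> X" using X SE by auto
      ultimately show ?thesis using indep[of X] by simp
    qed
    then show ?thesis unfolding restrict_def uniform_on_def by auto
  qed
  then have 1: "uniform (restrict ?M ?A)"
    by (simp add: uniform_uniform_on)
  have SS: "E - ?A = S" using SE by blast
  have "contract ?M ?A = uniform_on S (card S - 1)"
  proof -
    have "rk ?M (X \<union> ?A) = card X + rk ?M ?A \<longleftrightarrow> card X \<le> card S - 1" if X: "X \<subseteq> S" for X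
    proof (cases "X = S")
      case True
      then have "X \<union> ?A = E" using SE by blast
      then have "rk ?M (X \<union> ?A) + 2 = card E" using rank_partition_dual[OF fin part P2] by simp
      moreover have "card E = card ?A + card S" by (rule card_compl[OF fin part P2 SE(1)])
      moreover have "0 < card S" using SE(3) finS by (simp add: card_gt_0_iff)
      ultimately show ?thesis using True rkA by simp
    next
      case False
      then have XS: "X \<subset> S" using X by blast
      then have "card X < card S" by (intro psubset_card_mono finS)
      have T: "S - X \<subseteq> S" "S - X \<noteq> {}" using XS by auto
      have "E - (S - X) = X \<union> ?A" using X SE by blast
      then have "rk ?M (X \<union> ?A) + 1 = card (X \<union> ?A)" using rk_block[OF fin part P2 T(1) S T(2)] by simp
      moreover have "card (X \<union> ?A) = card X + card ?A"
        using X finS fin finite_subset by (intro card_Un_disjoint) auto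
      ultimately show ?thesis using rkA \<open>card X < card S\<close> by simp
    qed
    then show ?thesis unfolding contract_def uniform_on_def ground_partition_dual SS by auto
  qed
  then have "uniform (contract ?M ?A)"
    by (simp add: uniform_uniform_on)
  then show "stressed ?M ?A" using 1 by (simp add: stressed_def)
qed

lemma num_stressed_partition_dual:
  "num_stressed (partition_dual E P) r = card {S \<in> P. card S + r + 1 = card E}"
proof -
  let ?M = "partition_dual E P"
  have "bij_betw (\<lambda>S. E - S) {S \<in> P. card S + r + 1 = card E} {A. stressed ?M A \<and> rk ?M A = r \<and> card A = r + 1}"
  proof (rule bij_betwI[of _ _ _ "\<lambda>A. E - A"])
    show "(\<lambda>S. E - S) \<in> {S \<in> P. card S + r + 1 = card E} \<rightarrow> {A. stressed ?M A \<and> rk ?M A = r \<and> card A = r + 1}"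
    proof
      fix S assume S: "S \<in> {S \<in> P. card S + r + 1 = card E}"
      then have "card E = card (E - S) + card S"
        using card_compl[OF fin part P2] block_subset[OF fin part P2, of S] by blast
      then show "E - S \<in> {A. stressed ?M A \<and> rk ?M A = r \<and> card A = r + 1}"
        using compl_block_stressed[of S] S by auto
    qed
    show "(\<lambda>A. E - A) \<in> {A. stressed ?M A \<and> rk ?M A = r \<and> card A = r + 1} \<rightarrow> {S \<in> P. card S + r + 1 = card E}"
    proof
      fix A assume A: "A \<in> {A. stressed ?M A \<and> rk ?M A = r \<and> card A = r + 1}"
      then have "A \<subseteq> E" by (auto simp: stressed_def)
      then have "card E = card (E - A) + card A" by (rule card_compl[OF fin part P2])
      then show "E - A \<in> {S \<in> P. card S + r + 1 = card E}"
        using stressed_circuit_compl_block[of A] A by auto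
    qed
    fix S assume "S \<in> {S \<in> P. card S + r + 1 = card E}"
    then show "E - (E - S) = S" using block_subset[OF fin part P2, of S] by auto
  next
    fix A assume "A \<in> {A. stressed ?M A \<and> rk ?M A = r \<and> card A = r + 1}"
    then show "E - (E - A) = A" by (auto simp: stressed_def)
  qed
  from bij_betw_same_card[OF this] show ?thesis unfolding num_stressed_def by (rule sym)
qed

text \<open>A block S is recorded at r = n - 1 - |S|, the rank of the circuit \<open>E - S\<close>,
  so its size is recovered as n - r - 1.\<close>

lemma sum_num_stressed:
  fixes f :: "nat \<Rightarrow> int poly"
  shows "(\<Sum>r<card E. of_nat (num_stressed (partition_dual E P) r) * f (card E - r - 1)) = (\<Sum>S\<in>P. f (card S))"
proof -
  have cS: "0 < card S \<and> card S \<le> card E" if "S \<in> P" for S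
    using block_nonempty[OF fin part P2 that] block_finite[OF fin part P2 that]
      card_mono[OF fin block_subset[OF fin part P2 that]] by (simp add: card_gt_0_iff)
  have "(\<Sum>S\<in>P. f (card S)) = (\<Sum>r<card E. \<Sum>S\<in>{S \<in> P. card E - 1 - card S = r}. f (card S))"
  proof (rule sum.group[symmetric])
    show "(\<lambda>S. card E - 1 - card S) ` P \<subseteq> {..<card E}"
    proof (rule image_subsetI)
      fix S assume "S \<in> P"
      from cS[OF this] show "card E - 1 - card S \<in> {..<card E}" by simp
    qed
  qed (simp_all add: finite_P[OF fin part P2])
  also have "\<dots> = (\<Sum>r<card E. of_nat (num_stressed (partition_dual E P) r) * f (card E - r - 1))"
  proof (rule sum.cong)
    fix r assume "r \<in> {..<card E}"
    \<comment> \<open>By truncated subtraction a block of size n would be recorded at r = 0,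
      together with those of size n - 1.\<close>
    have neq: "card S \<noteq> card E" if "S \<in> P" for S
      using card_subset_eq[OF fin block_subset[OF fin part P2 that]] block_neq_ground[OF fin part P2 that] by blast
    have "{S \<in> P. card E - 1 - card S = r} = {S \<in> P. card S + r + 1 = card E}"
    proof (rule Collect_cong, rule conj_cong)
      fix S assume "S \<in> P"
      from cS[OF this] neq[OF this] show "card E - 1 - card S = r \<longleftrightarrow> card S + r + 1 = card E" by linarith
    qed simp
    then have "(\<Sum>S\<in>{S \<in> P. card E - 1 - card S = r}. f (card S)) =
        (\<Sum>S\<in>{S \<in> P. card S + r + 1 = card E}. f (card E - r - 1))"
    proof (intro sum.cong arg_cong[of _ _ f])
      fix S assume "S \<in> {S \<in> P. card S + r + 1 = card E}"
      then have "card S + r + 1 = card E" by blast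
      then show "card S = card E - r - 1" by linarith
    qed
    then show "(\<Sum>S\<in>{S \<in> P. card E - 1 - card S = r}. f (card S)) =
      of_nat (num_stressed (partition_dual E P) r) * f (card E - r - 1)"
      by (simp add: num_stressed_partition_dual)
  qed simp
  finally show ?thesis by simp
qed

end

section \<open>Two glued cycles\<close>

text \<open>The edge following or preceding e in cyclic order shares v. It differs from e because
  the absence of loops excludes length 1.\<close>

lemma graph_cycle_degree_two:
  assumes cyc: "graph_cycle ends es" and no_loop: "\<And>e v. e \<in> set es \<Longrightarrow> ends e \<noteq> {v}"
    and e: "e \<in> set es" "v \<in> ends e"
  shows "\<exists>e'\<in>set es. e' \<noteq> e \<and> v \<in> ends e'"
proof -
  let ?L = "length es"
  obtain vs where es: "es \<noteq> []" "distinct es" and vs: "length vs = ?L"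
    "\<forall>i<?L. ends (es ! i) = {vs ! i, vs ! (Suc i mod ?L)}"
    using cyc unfolding graph_cycle_def by blast
  obtain i where i: "i < ?L" "e = es ! i" using e(1) by (metis in_set_conv_nth)
  have "?L \<noteq> 1"
  proof
    assume 1: "?L = 1"
    then have "ends (es ! 0) = {vs ! 0}" using vs(2) by simp
    then show False using no_loop[of "es ! 0"] 1 by simp
  qed
  then have L: "2 \<le> ?L" using es(1) by (cases es) (auto simp: Suc_le_eq)
  have other: "\<exists>e'\<in>set es. e' \<noteq> e \<and> v \<in> ends e'" if j: "j < ?L" "j \<noteq> i" "v \<in> ends (es ! j)" for j
    using j i es(2) by (intro bexI[of _ "es ! j"]) (auto simp: nth_eq_iff_index_eq)
  have "v = vs ! i \<or> v = vs ! (Suc i mod ?L)" using vs(2) i e(2) by auto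
  then show ?thesis
  proof
    assume v: "v = vs ! (Suc i mod ?L)"
    have "Suc i mod ?L < ?L" using L by (intro mod_less_divisor) linarith
    moreover have "Suc i mod ?L \<noteq> i" using L i(1) by (cases "Suc i = ?L") auto
    ultimately show ?thesis using other[of "Suc i mod ?L"] vs(2) v by auto
  next
    assume v: "v = vs ! i"
    \<comment> \<open>The preceding edge in cyclic order, which also ends at
      \<open>vs ! i\<close>.\<close>
    define j where "j = (if i = 0 then ?L - 1 else i - 1)"
    have j: "j < ?L" "j \<noteq> i" "Suc j mod ?L = i" using L i(1) by (auto simp: j_def)
    then show ?thesis using other[of j] vs(2) v by auto
  qed
qed

context
  fixes a b :: nat
  assumes a: "2 \<le> a" and b: "2 \<le> b"
begin

section \<open>Edges and cycles of the glued graph\<close>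

lemma glued_ends_first: "i < a - 1 \<Longrightarrow> glued_cycles_ends a b i = {i, Suc i}"
  by (auto simp: glued_cycles_ends_def)

lemma glued_ends_common: "glued_cycles_ends a b (a - Suc 0) = {a - Suc 0, 0}"
  using a by (simp add: glued_cycles_ends_def)

lemma glued_ends_second: "a \<le> i \<Longrightarrow> i < a + b - 2 \<Longrightarrow> glued_cycles_ends a b i = {i - 1, i}"
  by (simp add: glued_cycles_ends_def)

lemma glued_ends_last: "glued_cycles_ends a b (a + b - 2) = {a + b - 3, 0}"
  using a b by (simp add: glued_cycles_ends_def)

lemma glued_edge_cases:
  assumes "e < a + b - 1"
  obtains "e < a - 1" | "e = a - 1" | "a \<le> e" "e < a + b - 2" | "e = a + b - 2"
  using assms by linarith

lemma glued_no_loop: "e < a + b - 1 \<Longrightarrow> glued_cycles_ends a b e \<noteq> {v}"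
  using a b by (erule_tac glued_edge_cases)
    (auto simp: glued_ends_first glued_ends_common glued_ends_second glued_ends_last doubleton_eq_iff)

text \<open>The graph consists of three paths between the branch vertices 0 and a - 1; these are
  their edge sets, and leaving out one path gives a cycle.\<close>

definition glued_blocks :: "nat set set" where
  "glued_blocks = {{..<a - 1}, {a..<a + b - 1}, {a - 1}}"

text \<open>Inner vertices of the three paths between the two branch vertices have degree 2, so an edge
  set with minimum degree 2 is a union of at least two of these paths.\<close>

lemma glued_cycle_supset:
  assumes cyc: "graph_cycle (glued_cycles_ends a b) es" and sub: "set es \<subseteq> {..<a + b - 1}"
  shows "\<exists>S\<in>glued_blocks. {..<a + b - 1} - S \<subseteq> set es"
proof -
  let ?Z = "set es" and ?g = "glued_cycles_ends a b"
  have deg: "\<exists>e'\<in>?Z. e' \<noteq> e \<and> v \<in> ?g e'" if "e \<in> ?Z" "v \<in> ?g e" for e v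
    using graph_cycle_degree_two[OF cyc _ that] glued_no_loop sub by blast
  have at1: "e = v - 1 \<or> e = v" if "0 < v" "v < a - 1" "e < a + b - 1" "v \<in> ?g e" for e v
    using that(3) by (cases rule: glued_edge_cases)
      (use that a b in \<open>auto simp: glued_ends_first glued_ends_common glued_ends_second glued_ends_last\<close>)
  have at2: "e = v \<or> e = Suc v" if "a \<le> v" "v \<le> a + b - 3" "e < a + b - 1" "v \<in> ?g e" for e v
    using that(3) by (cases rule: glued_edge_cases)
      (use that a b in \<open>auto simp: glued_ends_first glued_ends_common glued_ends_second glued_ends_last\<close>)
  have at0: "e = 0 \<or> e = a - 1 \<or> e = a + b - 2" if "e < a + b - 1" "0 \<in> ?g e" for e
    using that(1) by (cases rule: glued_edge_cases)
      (use that a b in \<open>auto simp: glued_ends_first glued_ends_common glued_ends_second glued_ends_last\<close>)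
  have in0: "0 \<in> ?g 0" "0 \<in> ?g (a - 1)" "0 \<in> ?g (a + b - 2)"
    using a b by (simp_all add: glued_ends_first glued_ends_common glued_ends_last)
  have step1: "i \<in> ?Z \<longleftrightarrow> Suc i \<in> ?Z" if "Suc i < a - 1" for i
  proof -
    have "Suc i \<in> ?g i" "Suc i \<in> ?g (Suc i)" using that by (simp_all add: glued_ends_first)
    then show ?thesis using deg[of i "Suc i"] deg[of "Suc i" "Suc i"] at1[of "Suc i"] that sub by force
  qed
  have step2: "i \<in> ?Z \<longleftrightarrow> Suc i \<in> ?Z" if "a \<le> i" "Suc i \<le> a + b - 2" for i
  proof -
    have "i \<in> ?g i" using that by (simp add: glued_ends_second)
    moreover have "i \<in> ?g (Suc i)"
      using that by (cases "Suc i = a + b - 2") (auto simp: glued_ends_second glued_ends_last)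
    moreover have "i \<le> a + b - 3" using that by linarith
    ultimately show ?thesis using deg[of i i] deg[of "Suc i" i] at2[of i] that sub by force
  qed
  have path1: "i \<in> ?Z \<longleftrightarrow> 0 \<in> ?Z" if "i < a - 1" for i
    using that
  proof (induction i)
    case (Suc i)
    then show ?case using step1[of i] by simp
  qed simp
  have path2: "i \<in> ?Z \<longleftrightarrow> a \<in> ?Z" if "a \<le> i" "i \<le> a + b - 2" for i
    using that
  proof (induction i rule: dec_induct)
    case (step i)
    then show ?case using step2[of i] by simp
  qed simp
  have last: "a + b - 2 \<in> ?Z \<longleftrightarrow> a \<in> ?Z" using path2[of "a + b - 2"] a b by simp
  obtain z where z: "z \<in> ?Z" using cyc unfolding graph_cycle_def by (metis list.set_sel(1))
  have "0 \<in> ?Z \<or> a - 1 \<in> ?Z \<or> a \<in> ?Z"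
  proof (cases "z < a - 1")
    case False
    then consider "z = a - 1" | "a \<le> z" by linarith
    then show ?thesis
    proof cases
      case 2
      moreover have "z \<le> a + b - 2" using z sub by auto
      ultimately show ?thesis using path2[of z] z by simp
    qed (use z in simp)
  next
    case True
    then show ?thesis using path1[OF True] z by blast
  qed
  \<comment> \<open>Each path has an edge at vertex 0, so a path that is used needs a second edge
    there, which belongs to another path.\<close>
  then have two: "(0 \<in> ?Z \<and> a - 1 \<in> ?Z) \<or> (0 \<in> ?Z \<and> a \<in> ?Z) \<or> (a - 1 \<in> ?Z \<and> a \<in> ?Z)"
  proof -
    have nb: "\<exists>e'\<in>{0, a - 1, a + b - 2} \<inter> ?Z. e' \<noteq> e" if "e \<in> ?Z" "0 \<in> ?g e" for e
    proof -
      obtain e' where e': "e' \<in> ?Z" "e' \<noteq> e" "0 \<in> ?g e'" using deg[OF \<open>e \<in> ?Z\<close> \<open>0 \<in> ?g e\<close>] by blast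
      moreover have "e' < a + b - 1" using e'(1) sub by blast
      ultimately show ?thesis using at0[of e'] by blast
    qed
    show ?thesis
      using \<open>0 \<in> ?Z \<or> a - 1 \<in> ?Z \<or> a \<in> ?Z\<close> nb[OF _ in0(1)] nb[OF _ in0(2)] nb[OF _ in0(3)] last by blast
  qed
  have p1: "{..<a - 1} \<subseteq> ?Z" if "0 \<in> ?Z" using path1 that by blast
  have p2: "{a..<a + b - 1} \<subseteq> ?Z" if "a \<in> ?Z"
  proof
    fix i assume "i \<in> {a..<a + b - 1}"
    then have "a \<le> i" "i \<le> a + b - 2" by auto
    then show "i \<in> ?Z" using path2[of i] that by blast
  qed
  have E: "{..<a + b - 1} = {..<a - 1} \<union> {a..<a + b - 1} \<union> {a - 1}" using a b by auto
  from two show ?thesis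
  proof (elim disjE conjE)
    assume "0 \<in> ?Z" "a - 1 \<in> ?Z"
    then have "{..<a + b - 1} - {a..<a + b - 1} \<subseteq> ?Z" using p1 unfolding E by blast
    then show ?thesis unfolding glued_blocks_def by blast
  next
    assume "0 \<in> ?Z" "a \<in> ?Z"
    then have "{..<a + b - 1} - {a - 1} \<subseteq> ?Z" using p1 p2 unfolding E by blast
    then show ?thesis unfolding glued_blocks_def by blast
  next
    assume "a - 1 \<in> ?Z" "a \<in> ?Z"
    then have "{..<a + b - 1} - {..<a - 1} \<subseteq> ?Z" using p2 unfolding E by blast
    then show ?thesis unfolding glued_blocks_def by blast
  qed
qed

lemma glued_block_compl_cycle:
  assumes "S \<in> glued_blocks"
  shows "\<exists>es. graph_cycle (glued_cycles_ends a b) es \<and> set es = {..<a + b - 1} - S"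
proof -
  consider "S = {..<a - 1}" | "S = {a..<a + b - 1}" | "S = {a - 1}" using assms by (auto simp: glued_blocks_def)
  then show ?thesis
  proof cases
    case 1
    \<comment> \<open>The vertex list begins at 0 because the common edge, listed first, joins 0 to
      a - 1, where the second path starts.\<close>
    let ?es = "[a - 1..<a + b - 1]" and ?vs = "0 # [a - 1..<a + b - 2]"
    have len: "length ?es = b" "length ?vs = b" using a b by auto
    have "glued_cycles_ends a b (?es ! i) = {?vs ! i, ?vs ! (Suc i mod length ?es)}" if i: "i < b" for i
    proof -
      consider "i = 0" | "0 < i" "i < b - 1" | "0 < i" "i = b - 1" using i by linarith
      then show ?thesis
      proof cases
        case 1
        then show ?thesis using a b by (simp add: glued_ends_common insert_commute)
      next
        case 2
        have "?es ! i = a - 1 + i" using 2 by simp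
        moreover have "?vs ! i = a - 1 + i - 1" "?vs ! (Suc i mod length ?es) = a - 1 + i"
          using 2 a b by (simp_all add: nth_Cons')
        moreover have "glued_cycles_ends a b (a - 1 + i) = {a - 1 + i - 1, a - 1 + i}"
          using 2 a b by (intro glued_ends_second) auto
        ultimately show ?thesis by simp
      next
        case 3
        have "?es ! i = a + b - 2" using 3 a b by simp
        moreover have "?vs ! i = a + b - 3" "?vs ! (Suc i mod length ?es) = 0"
          using 3 a b by (simp_all add: nth_Cons')
        ultimately show ?thesis using glued_ends_last by simp
      qed
    qed
    moreover have "distinct ?vs" using a by simp
    ultimately have "graph_cycle (glued_cycles_ends a b) ?es"
      unfolding graph_cycle_def using len b by (intro conjI exI[of _ ?vs]) auto
    moreover have "set ?es = {..<a + b - 1} - S" using 1 by auto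
    ultimately show ?thesis by blast
  next
    case 2
    have "graph_cycle (glued_cycles_ends a b) [0..<a]"
      unfolding graph_cycle_def using a
      by (intro conjI exI[of _ "[0..<a]"]) (auto simp: glued_cycles_ends_def)
    moreover have "set [0..<a] = {..<a + b - 1} - S" using 2 b by auto
    ultimately show ?thesis by blast
  next
    case 3
    let ?L = "a + b - 2"
    let ?es = "[0..<a - 1] @ [a..<a + b - 1]" and ?vs = "[0..<?L]"
    have len: "length ?es = ?L" "length ?vs = ?L" using a b by auto
    have "glued_cycles_ends a b (?es ! i) = {?vs ! i, ?vs ! (Suc i mod length ?es)}" if i: "i < ?L" for i
    proof -
      have L: "Suc i mod ?L < ?L" using i by simp
      \<comment> \<open>Skipping the common edge shifts the later edge indices by one, while the
        outer cycle visits the vertices in their numerical order.\<close>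
      have "glued_cycles_ends a b (?es ! i) = {i, Suc i mod ?L}"
      proof (cases "i < a - 1")
        case True
        then show ?thesis using b glued_ends_first[of i] by (simp add: nth_append)
      next
        case False
        then have "?es ! i = Suc i" using a i by (simp add: nth_append)
        moreover have "\<not> Suc i < a" using False by simp
        ultimately show ?thesis by (simp add: glued_cycles_ends_def)
      qed
      then show ?thesis unfolding len(1) using i L by simp
    qed
    then have "graph_cycle (glued_cycles_ends a b) ?es"
      unfolding graph_cycle_def using len a b by (intro conjI exI[of _ ?vs]) auto
    moreover have "set ?es = {..<a + b - 1} - S" using 3 a b by auto
    ultimately show ?thesis by blast
  qed
qed

text \<open>The graph cycles need not be listed: each one contains the complement of a block, and
  these complements are themselves cycles, so both matroids have the same dependent sets.\<close>

lemma C_eq_partition_dual: "C a b = partition_dual {..<a + b - 1} glued_blocks"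
proof -
  let ?E = "{..<a + b - 1}"
  have "\<not> (\<exists>es. set es \<subseteq> X \<and> graph_cycle (glued_cycles_ends a b) es) \<longleftrightarrow> (\<forall>S\<in>glued_blocks. \<not> ?E - X \<subseteq> S)"
    if X: "X \<subseteq> ?E" for X
  proof -
    have "(\<exists>es. set es \<subseteq> X \<and> graph_cycle (glued_cycles_ends a b) es) \<longleftrightarrow> (\<exists>S\<in>glued_blocks. ?E - S \<subseteq> X)"
    proof
      assume "\<exists>es. set es \<subseteq> X \<and> graph_cycle (glued_cycles_ends a b) es"
      then obtain es where es: "set es \<subseteq> X" "graph_cycle (glued_cycles_ends a b) es" by blast
      then have "set es \<subseteq> ?E" using X by blast
      from glued_cycle_supset[OF es(2) this] show "\<exists>S\<in>glued_blocks. ?E - S \<subseteq> X" using es(1) by blast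
    next
      assume "\<exists>S\<in>glued_blocks. ?E - S \<subseteq> X"
      then obtain S where "S \<in> glued_blocks" "?E - S \<subseteq> X" by blast
      then show "\<exists>es. set es \<subseteq> X \<and> graph_cycle (glued_cycles_ends a b) es"
        using glued_block_compl_cycle[of S] by blast
    qed
    moreover have "?E - S \<subseteq> X \<longleftrightarrow> ?E - X \<subseteq> S" for S by blast
    ultimately show ?thesis by simp
  qed
  then show ?thesis unfolding C_def graphic_matroid_def partition_dual_def by auto
qed

section \<open>Polynomials of the glued cycles\<close>

lemma glued_blocks_distinct:
  "{..<a - 1} \<noteq> {a..<a + b - 1}" "{..<a - 1} \<noteq> {a - 1}" "{a..<a + b - 1} \<noteq> {a - 1}"
proof -
  have "0 \<in> {..<a - 1}" "0 \<notin> {a..<a + b - 1}" "0 \<notin> {a - 1}" "a - 1 \<notin> {a..<a + b - 1}" "a - 1 \<in> {a - 1}"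
    using a by auto
  then show "{..<a - 1} \<noteq> {a..<a + b - 1}" "{..<a - 1} \<noteq> {a - 1}" "{a..<a + b - 1} \<noteq> {a - 1}" by metis+
qed

lemma partition_on_glued_blocks: "partition_on {..<a + b - 1} glued_blocks"
proof (rule partition_onI)
  show "\<Union>glued_blocks = {..<a + b - 1}" using a b by (auto simp: glued_blocks_def)
  show "{} \<notin> glued_blocks" using a b by (auto simp: glued_blocks_def lessThan_empty_iff eq_commute[of "{}"])
qed (use a b in \<open>auto simp: glued_blocks_def disjnt_iff\<close>)

lemma card_glued_blocks: "2 \<le> card glued_blocks"
  using glued_blocks_distinct by (simp add: glued_blocks_def)

text \<open>The common edge forms a block of size 1, where \<open>rho\<close> vanishes.\<close>

lemma sum_rho_glued_blocks:
  "(\<Sum>S\<in>glued_blocks. rho n (card S)) = rho n (a - 1) + rho n (b - 1)"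
  using glued_blocks_distinct a by (simp add: glued_blocks_def rho_1)

lemma
  shows inv_KL_C: "inv_KL (C a b) =
      trunc (a + b - 3) (kappa (a + b - 1) + (rho (a + b - 1) (a - 1) + rho (a + b - 1) (b - 1)))"
    and inv_Z_C: "inv_Z (C a b) =
      trunc (a + b - 3) (kappa (a + b - 1) + (rho (a + b - 1) (a - 1) + rho (a + b - 1) (b - 1))) +
      (kappa (a + b - 1) + (rho (a + b - 1) (a - 1) + rho (a + b - 1) (b - 1)))"
proof -
  have 3: "a + b - 1 - 2 = a + b - 3" using a by simp
  note * = finite_lessThan partition_on_glued_blocks card_glued_blocks
  show "inv_KL (C a b) =
      trunc (a + b - 3) (kappa (a + b - 1) + (rho (a + b - 1) (a - 1) + rho (a + b - 1) (b - 1)))"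
    unfolding C_eq_partition_dual inv_KL_partition_dual[OF *] card_lessThan sum_rho_glued_blocks 3 ..
  show "inv_Z (C a b) =
      trunc (a + b - 3) (kappa (a + b - 1) + (rho (a + b - 1) (a - 1) + rho (a + b - 1) (b - 1))) +
      (kappa (a + b - 1) + (rho (a + b - 1) (a - 1) + rho (a + b - 1) (b - 1)))"
    unfolding C_eq_partition_dual inv_Z_partition_dual[OF *] card_lessThan sum_rho_glued_blocks 3 ..
qed

end

section \<open>Proof of the theorem\<close>

lemma
  assumes "0 < m"
  shows inv_KL_U_corank_1: "inv_KL (U (m - 1) m) = qcirc m"
    and inv_Z_U_corank_1: "inv_Z (U (m - 1) m) = qcirc m + var * H m"
proof -
  have "{..<m} \<noteq> {}" using assms by auto
  then show "inv_KL (U (m - 1) m) = qcirc m" "inv_Z (U (m - 1) m) = qcirc m + var * H m"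
    using inv_KL_circuit_matroid[of "{..<m}" "{..<m}"] inv_Z_circuit_matroid[of "{..<m}"]
    unfolding U_corank_1[OF assms] by simp_all
qed

lemma
  assumes "2 \<le> n"
  shows inv_KL_U_corank_2: "inv_KL (U (n - 2) n) = trunc (n - 2) (kappa n)"
    and inv_Z_U_corank_2: "inv_Z (U (n - 2) n) = trunc (n - 2) (kappa n) + kappa n"
proof -
  let ?P = "(\<lambda>i. {i}) ` {..<n}"
  have "card ?P = n" by (subst card_image) auto
  moreover have "(\<Sum>S\<in>?P. rho n (card S)) = 0" by (intro sum.neutral) (auto simp: rho_1)
  ultimately show "inv_KL (U (n - 2) n) = trunc (n - 2) (kappa n)"
    "inv_Z (U (n - 2) n) = trunc (n - 2) (kappa n) + kappa n"
    using inv_KL_partition_dual[of "{..<n}" ?P] inv_Z_partition_dual[of "{..<n}" ?P] assms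
      partition_on_singletons[of "{..<n}"]
    unfolding U_corank_2[OF assms] by simp_all
qed

text \<open>The block size n - a occurs on both sides, so \<open>kappa n\<close> and
  \<open>rho n (n - a)\<close> cancel and a difference at consecutive sizes is left. For a = n - 1
  the last factor is the loop \<open>U 0 1\<close>, in accordance with
  \<open>qcirc 1 = 0\<close>.\<close>

lemma
  assumes "2 \<le> a" "a < n"
  shows inv_KL_C_diff: "inv_KL (C a (n + 1 - a)) - inv_KL (U (a - 1) a) * inv_KL (U (n - a - 1) (n - a)) =
      trunc (n - 2) (rho n (a - 1)) - trunc (n - 2) (rho n a)"
    and inv_Z_C_diff: "inv_Z (C a (n + 1 - a)) - inv_Z (U (a - 1) a) * inv_Z (U (n - a - 1) (n - a)) =
      (trunc (n - 2) (rho n (a - 1)) + rho n (a - 1)) - (trunc (n - 2) (rho n a) + rho n a)"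
proof -
  have b: "2 \<le> n + 1 - a" "a + (n + 1 - a) - 3 = n - 2" "a + (n + 1 - a) - 1 = n" "n + 1 - a - 1 = n - a"
    using assms by auto
  have pos: "0 < a" "0 < n - a" "a + (n - a) = n" using assms by auto
  note U = inv_KL_U_corank_1[OF pos(1)] inv_KL_U_corank_1[OF pos(2)]
    inv_Z_U_corank_1[OF pos(1)] inv_Z_U_corank_1[OF pos(2)]
  note two = trunc_two_blocks[OF pos, symmetric] kappa_rho_two_blocks[OF pos, symmetric]
  note C = inv_KL_C[OF assms(1) b(1), unfolded b(2-4)] inv_Z_C[OF assms(1) b(1), unfolded b(2-4)]
  show "inv_KL (C a (n + 1 - a)) - inv_KL (U (a - 1) a) * inv_KL (U (n - a - 1) (n - a)) =
      trunc (n - 2) (rho n (a - 1)) - trunc (n - 2) (rho n a)"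
    unfolding C U two(1) by (simp add: trunc_add)
  show "inv_Z (C a (n + 1 - a)) - inv_Z (U (a - 1) a) * inv_Z (U (n - a - 1) (n - a)) =
      (trunc (n - 2) (rho n (a - 1)) + rho n (a - 1)) - (trunc (n - 2) (rho n a) + rho n a)"
    unfolding C U two(2) unfolding two(1) by (simp add: trunc_add)
qed

section \<open>Telescoping over block sizes\<close>

lemma sum_telescope_pred:
  fixes g :: "nat \<Rightarrow> 'b :: ab_group_add"
  assumes "0 < s"
  shows "(\<Sum>a = 2..s. g (a - 1) - g a) = g 1 - g s"
proof -
  obtain k where k: "s = Suc k" using assms gr0_conv_Suc by auto
  show ?thesis unfolding k by (induction k) simp_all
qed

lemma trunc_sum: "trunc d (sum f A) = (\<Sum>x\<in>A. trunc d (f x))"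
  by (induction A rule: infinite_finite_induct) (simp_all add: trunc_add)

lemma
  assumes fin: "finite E" and part: "partition_on E P" and P2: "2 \<le> card P" and n: "card E = n"
  shows inv_KL_partition_dual_valuative: "inv_KL (partition_dual E P) = inv_KL (U (n - 2) n) -
      (\<Sum>S\<in>P. \<Sum>a = 2..card S. inv_KL (C a (n + 1 - a)) - inv_KL (U (a - 1) a) * inv_KL (U (n - a - 1) (n - a)))"
    and inv_Z_partition_dual_valuative: "inv_Z (partition_dual E P) = inv_Z (U (n - 2) n) -
      (\<Sum>S\<in>P. \<Sum>a = 2..card S. inv_Z (C a (n + 1 - a)) - inv_Z (U (a - 1) a) * inv_Z (U (n - a - 1) (n - a)))"
proof -
  have n2: "2 \<le> n" using rank_partition_dual[OF fin part P2] n by simp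
  \<comment> \<open>Blocks are proper subsets of E, so a stays below n, as the difference formulas
    require.\<close>
  have cS: "0 < card S" "card S < n" if "S \<in> P" for S
  proof -
    show "0 < card S"
      using block_nonempty[OF fin part P2 that] block_finite[OF fin part P2 that] by (simp add: card_gt_0_iff)
    have "S \<subset> E" using block_subset[OF fin part P2 that] block_neq_ground[OF fin part P2 that] by blast
    then show "card S < n" unfolding n[symmetric] by (rule psubset_card_mono[OF fin])
  qed
  have KL: "(\<Sum>a = 2..card S. inv_KL (C a (n + 1 - a)) - inv_KL (U (a - 1) a) * inv_KL (U (n - a - 1) (n - a))) =
      - trunc (n - 2) (rho n (card S))" if "S \<in> P" for S
  proof -
    have "(\<Sum>a = 2..card S. inv_KL (C a (n + 1 - a)) - inv_KL (U (a - 1) a) * inv_KL (U (n - a - 1) (n - a))) =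
      (\<Sum>a = 2..card S. trunc (n - 2) (rho n (a - 1)) - trunc (n - 2) (rho n a))"
      using cS[OF that] by (intro sum.cong inv_KL_C_diff) auto
    also have "\<dots> = - trunc (n - 2) (rho n (card S))"
      using sum_telescope_pred[OF cS(1)[OF that], of "\<lambda>a. trunc (n - 2) (rho n a)"] by (simp add: rho_1)
    finally show ?thesis .
  qed
  have Z: "(\<Sum>a = 2..card S. inv_Z (C a (n + 1 - a)) - inv_Z (U (a - 1) a) * inv_Z (U (n - a - 1) (n - a))) =
      - (trunc (n - 2) (rho n (card S)) + rho n (card S))" if "S \<in> P" for S
  proof -
    have "(\<Sum>a = 2..card S. inv_Z (C a (n + 1 - a)) - inv_Z (U (a - 1) a) * inv_Z (U (n - a - 1) (n - a))) =
      (\<Sum>a = 2..card S. (trunc (n - 2) (rho n (a - 1)) + rho n (a - 1)) - (trunc (n - 2) (rho n a) + rho n a))"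
      using cS[OF that] by (intro sum.cong inv_Z_C_diff) auto
    also have "\<dots> = - (trunc (n - 2) (rho n (card S)) + rho n (card S))"
      using sum_telescope_pred[OF cS(1)[OF that], of "\<lambda>a. trunc (n - 2) (rho n a) + rho n a"] by (simp add: rho_1)
    finally show ?thesis .
  qed
  have sum_KL: "(\<Sum>S\<in>P. \<Sum>a = 2..card S. inv_KL (C a (n + 1 - a)) - inv_KL (U (a - 1) a) * inv_KL (U (n - a - 1) (n - a))) =
      (\<Sum>S\<in>P. - trunc (n - 2) (rho n (card S)))"
    by (rule sum.cong[OF refl KL])
  have sum_Z: "(\<Sum>S\<in>P. \<Sum>a = 2..card S. inv_Z (C a (n + 1 - a)) - inv_Z (U (a - 1) a) * inv_Z (U (n - a - 1) (n - a))) =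
      (\<Sum>S\<in>P. - (trunc (n - 2) (rho n (card S)) + rho n (card S)))"
    by (rule sum.cong[OF refl Z])
  show "inv_KL (partition_dual E P) = inv_KL (U (n - 2) n) -
      (\<Sum>S\<in>P. \<Sum>a = 2..card S. inv_KL (C a (n + 1 - a)) - inv_KL (U (a - 1) a) * inv_KL (U (n - a - 1) (n - a)))"
    unfolding inv_KL_partition_dual[OF fin part P2] inv_KL_U_corank_2[OF n2] n sum_KL
    by (simp add: trunc_add trunc_sum sum_negf)
  show "inv_Z (partition_dual E P) = inv_Z (U (n - 2) n) -
      (\<Sum>S\<in>P. \<Sum>a = 2..card S. inv_Z (C a (n + 1 - a)) - inv_Z (U (a - 1) a) * inv_Z (U (n - a - 1) (n - a)))"
    unfolding inv_Z_partition_dual[OF fin part P2] inv_Z_U_corank_2[OF n2] n sum_Z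
    by (simp add: trunc_add trunc_sum sum_subtractf sum_negf)
qed

theorem theorem5p2:
  shows "(\<forall>(M :: 'a indep_system) n.
      matroid M \<and> card (ground M) = n \<and> n = rank M + 2 \<and> (\<forall>e. \<not> coloop M e) \<longrightarrow>
        inv_KL M = inv_KL (U (n - 2) n)
          - (\<Sum>r<n. of_nat (num_stressed M r) *
              (\<Sum>a = 2..n - r - 1. inv_KL (C a (n + 1 - a))
                 - inv_KL (U (a - 1) a) * inv_KL (U (n - a - 1) (n - a))))
      \<and> inv_Z M = inv_Z (U (n - 2) n)
          - (\<Sum>r<n. of_nat (num_stressed M r) *
              (\<Sum>a = 2..n - r - 1. inv_Z (C a (n + 1 - a))
                 - inv_Z (U (a - 1) a) * inv_Z (U (n - a - 1) (n - a)))))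
    \<and> (\<forall>(M :: nat indep_system) n P.
      arises_from_partition M {1..n} P \<longrightarrow>
        inv_KL M = inv_KL (U (n - 2) n)
          - (\<Sum>S\<in>{S \<in> P. card S \<ge> 2}. \<Sum>a = 2..card S. inv_KL (C a (n + 1 - a))
               - inv_KL (U (a - 1) a) * inv_KL (U (n - a - 1) (n - a)))
      \<and> inv_Z M = inv_Z (U (n - 2) n)
          - (\<Sum>S\<in>{S \<in> P. card S \<ge> 2}. \<Sum>a = 2..card S. inv_Z (C a (n + 1 - a))
               - inv_Z (U (a - 1) a) * inv_Z (U (n - a - 1) (n - a))))"
proof (rule conjI; intro allI impI)
  fix M :: "'a indep_system" and n
  assume "matroid M \<and> card (ground M) = n \<and> n = rank M + 2 \<and> (\<forall>e. \<not> coloop M e)"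
  then have M: "matroid M" "card (ground M) = rank M + 2" "\<forall>e. \<not> coloop M e" and n: "card (ground M) = n"
    by auto
  have fin: "finite (ground M)" by (rule finite_ground[OF M(1)])
  obtain P where P: "partition_on (ground M) P" "2 \<le> card P" and eq: "M = partition_dual (ground M) P"
    using coloopless_corank_2_partition_dual[OF M] by blast
  note sums = sum_num_stressed[OF fin P, folded eq, unfolded n]
  show "inv_KL M = inv_KL (U (n - 2) n)
          - (\<Sum>r<n. of_nat (num_stressed M r) *
              (\<Sum>a = 2..n - r - 1. inv_KL (C a (n + 1 - a))
                 - inv_KL (U (a - 1) a) * inv_KL (U (n - a - 1) (n - a))))
      \<and> inv_Z M = inv_Z (U (n - 2) n)
          - (\<Sum>r<n. of_nat (num_stressed M r) *
              (\<Sum>a = 2..n - r - 1. inv_Z (C a (n + 1 - a))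
                 - inv_Z (U (a - 1) a) * inv_Z (U (n - a - 1) (n - a))))"
    using inv_KL_partition_dual_valuative[OF fin P n, folded eq]
      inv_Z_partition_dual_valuative[OF fin P n, folded eq]
      sums[of "\<lambda>s. \<Sum>a = 2..s. inv_KL (C a (n + 1 - a)) - inv_KL (U (a - 1) a) * inv_KL (U (n - a - 1) (n - a))"]
      sums[of "\<lambda>s. \<Sum>a = 2..s. inv_Z (C a (n + 1 - a)) - inv_Z (U (a - 1) a) * inv_Z (U (n - a - 1) (n - a))"]
    by (simp only:)
next
  fix M :: "nat indep_system" and n P
  assume "arises_from_partition M {1..n} P"
  then have P: "partition_on {1..n} P" "2 \<le> card P" and eq: "M = partition_dual {1..n} P"
    using arises_from_partition_partition_dual by blast+
  have fin: "finite {1..n}" "card {1..n} = n" by simp_all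
  \<comment> \<open>For a block of size 1 the range from 2 to 1 is empty.\<close>
  have "(\<Sum>S\<in>P. \<Sum>a = 2..card S. f a) = (\<Sum>S\<in>{S \<in> P. card S \<ge> 2}. \<Sum>a = 2..card S. f a)" for f :: "nat \<Rightarrow> int poly"
    using finite_P[OF fin(1) P] by (intro sum.mono_neutral_right) auto
  then show "inv_KL M = inv_KL (U (n - 2) n)
          - (\<Sum>S\<in>{S \<in> P. card S \<ge> 2}. \<Sum>a = 2..card S. inv_KL (C a (n + 1 - a))
               - inv_KL (U (a - 1) a) * inv_KL (U (n - a - 1) (n - a)))
      \<and> inv_Z M = inv_Z (U (n - 2) n)
          - (\<Sum>S\<in>{S \<in> P. card S \<ge> 2}. \<Sum>a = 2..card S. inv_Z (C a (n + 1 - a))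
               - inv_Z (U (a - 1) a) * inv_Z (U (n - a - 1) (n - a)))"
    using inv_KL_partition_dual_valuative[OF fin(1) P fin(2), folded eq]
      inv_Z_partition_dual_valuative[OF fin(1) P fin(2), folded eq] by (simp only:)
qed

end
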